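(* Let $q$ be a prime power. Then $\mathbb{P}_{Q_q^+}\cong\mathrm{GF}(q)$; that is, the universal partial field of the matroid $Q_q^+$ is isomorphic to $\mathrm{GF}(q)$, regarded as the partial field $(\mathrm{GF}(q),\mathrm{GF}(q)^* )$.
   Context: $Q_q$ is the rank-3 matroid consisting of the points of three distinct $(q+1)$-point lines $L_1,L_2,L_3\subset\mathrm{PG}(2,q)$ with $L_1\cap L_2\cap L_3=\emptyset$. $Q_q^+$ is the matroid (restriction of $\mathrm{PG}(2,q)$) obtained from $Q_q$ by adding a point $e\in\mathrm{PG}(2,q)\setminus(L_1\cup L_2\cup L_3)$. A partial field is a pair $(R,G)$ with $R$ a commutative ring with identity and $G$ a subgroup of $R^*$ with $-1\in G$; as a set it is $G\cup\{0\}$. A partial-field homomorphism is a map $\phi:\mathbb{P}_1\to\mathbb{P}_2$ with $\phi(1)=1$, $\phi(pq)=\phi(p)\phi(q)$, and $\phi(p)+\phi(q)=\phi(p+q)$ whenever $p,q,p+q\in\mathbb{P}_1$. An isomorphism is a bijective homomorphism such that $\phi(p)+\phi(q)\in\mathbb{P}_2$ if and only if $p+q\in\mathbb{P}_1$. $\langle S\rangle$ is the multiplicative group generated by the nonzero elements of $S$. Universal partial field. Let $M=(E,\mathcal{B})$ be a matroid of rank $r$. For every $Z\in E^r$ introduce a symbol $[Z]$, and for every $Z\in E^r$ whose set of entries $\{Z\}$ is a basis, a symbol $\overline{[Z]}$. Let $I_M$ be the ideal, in the polynomial ring over $\mathbb{Z}$ in these symbols, generated by: (1) $[Z]$ for all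 $Z$ with $\{Z\}\notin\mathcal{B}$; (2) $[Z]-\mathrm{sgn}(\sigma)[Z^\sigma]$ for all $Z$ and permutations $\sigma$; (3) $[x_1,x_2,W][y_1,y_2,W]-[y_1,x_2,W][x_1,y_2,W]-[y_2,x_2,W][y_1,x_1,W]$ for all $x_1,x_2,y_1,y_2\in E$, $W\in E^{r-2}$; (4) $[Z]\overline{[Z]}-1$ for all $Z$ with $\{Z\}\in\mathcal{B}$. Let $\mathbb{B}_M$ be the quotient ring. For $B\in E^r$ with $\{B\}$ a basis, $A_{M,B}$ is the $\{B\}\times(E\setminus\{B\})$ matrix over $\mathbb{B}_M$ with $(A_{M,B})_{uv}=[B/u\to v]/[B]$, where $B/u\to v$ is $B$ with $u$ replaced by $v$; all its subdeterminants are zero or units. For an $X\times Y$ matrix $A$ all of whose subdeterminants are zero or units, $A'\preceq A$ means that $A'$ is obtained from $A$ by scaling rows or columns by units, deleting or permuting rows or columns, and pivoting (for $A_{xy}\neq0$, $A^{xy}$ is the $((X\setminus x)\cup y)\times((Y\setminus y)\cup x)$ matrix with $(A^{xy})_{yx}=A_{xy}^{-1}$, $(A^{xy})_{yv}=A_{xy}^{-1}A_{xv}$ for $v\neq x$, $(A^{xy})_{ux}=-A_{xy}^{-1}A_{uy}$ for $u\ne y$, $(A^{xy})_{uv}=A_{uv}-A_{xy}^{-1}A_{uy}A_{xv}$ otherwise). Put $\mathrm{Cr}(A)=\{p\mid\left[\begin{smallmatrix}1 & 1 \\ p & 1\end{smallmatrix}\right]\preceq A\}$ and $\mathrm{Cr}(M)=\mathrm{Cr}(A_{M,B})$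 (independent of $B$). Let $R_M=\mathbb{Z}[\mathrm{Cr}(M)]\subseteq\mathbb{B}_M$. The universal partial field of $M$ is $\mathbb{P}_M=(R_M,\langle\mathrm{Cr}(M)\cup\{-1\}\rangle)$. *)

theory Defs
  imports
    "HOL-Analysis.Analysis"
    "HOL-Library.Poly_Mapping"
    "HOL-Combinatorics.Permutations"
    "HOL-Number_Theory.Prime_Powers"
    "HOL-Algebra.QuotRing"
    "HOL-Algebra.Generated_Groups"
    "HOL-Algebra.Generated_Rings"
    "HOL-Algebra.Algebraic_Closure_Type"
begin

section \<open>Partial fields\<close>

type_synonym 'a pfield = "'a ring \<times> 'a set"

definition partial_field :: "'a pfield \<Rightarrow> bool" where
  "partial_field P \<longleftrightarrow> (case P of (R, G) \<Rightarrow>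
     cring R \<and> subgroup G (units_of R) \<and> \<ominus>\<^bsub>R\<^esub> \<one>\<^bsub>R\<^esub> \<in> G)"

definition pf_elems :: "'a pfield \<Rightarrow> 'a set" where
  "pf_elems P = (case P of (R, G) \<Rightarrow> insert \<zero>\<^bsub>R\<^esub> G)"

definition pf_hom :: "'a pfield \<Rightarrow> 'b pfield \<Rightarrow> ('a \<Rightarrow> 'b) set" where
  "pf_hom P1 P2 = (case (P1, P2) of ((R1, G1), (R2, G2)) \<Rightarrow>
     {\<phi>. partial_field P1 \<and> partial_field P2 \<and>
        (\<forall>p\<in>pf_elems P1. \<phi> p \<in> pf_elems P2) \<and>
        \<phi> \<one>\<^bsub>R1\<^esub> = \<one>\<^bsub>R2\<^esub> \<and>
        (\<forall>p\<in>pf_elems P1. \<forall>q\<in>pf_elems P1. \<phi> (p \<otimes>\<^bsub>R1\<^esub> q) = \<phi> p \<otimes>\<^bsub>R2\<^esub> \<phi> q) \<and>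
        (\<forall>p\<in>pf_elems P1. \<forall>q\<in>pf_elems P1. p \<oplus>\<^bsub>R1\<^esub> q \<in> pf_elems P1 \<longrightarrow>
           \<phi> p \<oplus>\<^bsub>R2\<^esub> \<phi> q = \<phi> (p \<oplus>\<^bsub>R1\<^esub> q))})"

definition pf_iso :: "'a pfield \<Rightarrow> 'b pfield \<Rightarrow> ('a \<Rightarrow> 'b) set" where
  "pf_iso P1 P2 = (case (P1, P2) of ((R1, G1), (R2, G2)) \<Rightarrow>
     {\<phi> \<in> pf_hom P1 P2. bij_betw \<phi> (pf_elems P1) (pf_elems P2) \<and>
        (\<forall>p\<in>pf_elems P1. \<forall>q\<in>pf_elems P1.
           \<phi> p \<oplus>\<^bsub>R2\<^esub> \<phi> q \<in> pf_elems P2 \<longleftrightarrow> p \<oplus>\<^bsub>R1\<^esub> q \<in> pf_elems P1)})"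

definition pf_isomorphic :: "'a pfield \<Rightarrow> 'b pfield \<Rightarrow> bool" where
  "pf_isomorphic P1 P2 \<longleftrightarrow> pf_iso P1 P2 \<noteq> {}"

definition field_pfield :: "('f :: field) pfield" where
  "field_pfield = (ring_of_type_algebra, UNIV - {0})"

section \<open>Matroids\<close>

text \<open>A matroid is given by its ground set and its set of bases.\<close>

type_synonym 'e matroid = "'e set \<times> 'e set set"

abbreviation ground :: "'e matroid \<Rightarrow> 'e set" where "ground \<equiv> fst"
abbreviation bases :: "'e matroid \<Rightarrow> 'e set set" where "bases \<equiv> snd"

definition is_matroid :: "'e matroid \<Rightarrow> bool" where
  "is_matroid M \<longleftrightarrow> finite (ground M) \<and> bases M \<subseteq> Pow (ground M) \<and> bases M \<noteq> {} \<and>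
     (\<forall>B1\<in>bases M. \<forall>B2\<in>bases M. \<forall>x\<in>B1 - B2. \<exists>y\<in>B2 - B1. insert y (B1 - {x}) \<in> bases M)"

text \<open>All bases of a matroid have the same cardinality.\<close>

definition matroid_rank :: "'e matroid \<Rightarrow> nat" where
  "matroid_rank M = card (SOME B. B \<in> bases M)"

section \<open>The bracket ring\<close>

text \<open>A polynomial is a finitely supported map from monomials to integer coefficients, and
  a monomial is a finitely supported map from symbols to exponents.\<close>

type_synonym 'v int_mpoly = "('v \<Rightarrow>\<^sub>0 nat) \<Rightarrow>\<^sub>0 int"

definition mvar :: "'v \<Rightarrow> 'v int_mpoly" where
  "mvar v = Poly_Mapping.single (Poly_Mapping.single v 1) 1"

definition int_mpoly_ring :: "'v set \<Rightarrow> 'v int_mpoly ring" where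
  "int_mpoly_ring V =
     ring_of_type_algebra \<lparr>carrier := {p. \<forall>m\<in>Poly_Mapping.keys p. Poly_Mapping.keys m \<subseteq> V}\<rparr>"

datatype 'e bracket = Bracket "'e list" | Inv_Bracket "'e list"

abbreviation br :: "'e list \<Rightarrow> 'e bracket int_mpoly" where
  "br Z \<equiv> mvar (Bracket Z)"

abbreviation inv_br :: "'e list \<Rightarrow> 'e bracket int_mpoly" where
  "inv_br Z \<equiv> mvar (Inv_Bracket Z)"

definition tuples :: "'e matroid \<Rightarrow> 'e list set" where
  "tuples M = {Z. length Z = matroid_rank M \<and> set Z \<subseteq> ground M}"

definition basis_tuples :: "'e matroid \<Rightarrow> 'e list set" where
  "basis_tuples M = {Z \<in> tuples M. set Z \<in> bases M}"

definition bracket_poly_ring :: "'e matroid \<Rightarrow> 'e bracket int_mpoly ring" where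
  "bracket_poly_ring M =
     int_mpoly_ring (Bracket ` tuples M \<union> Inv_Bracket ` basis_tuples M)"

definition bracket_relations :: "'e matroid \<Rightarrow> 'e bracket int_mpoly set" where
  "bracket_relations M =
     {br Z | Z. Z \<in> tuples M \<and> set Z \<notin> bases M} \<union>
     {br Z - of_int (sign \<sigma>) * br (permute_list \<sigma> Z) | Z \<sigma>.
        Z \<in> tuples M \<and> \<sigma> permutes {..<matroid_rank M}} \<union>
     {br (x1 # x2 # W) * br (y1 # y2 # W) - br (y1 # x2 # W) * br (x1 # y2 # W)
        - br (y2 # x2 # W) * br (y1 # x1 # W) | x1 x2 y1 y2 W.
        {x1, x2, y1, y2} \<union> set W \<subseteq> ground M \<and> length W + 2 = matroid_rank M} \<union>
     {br Z * inv_br Z - 1 | Z. Z \<in> basis_tuples M}"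

definition bracket_ideal :: "'e matroid \<Rightarrow> 'e bracket int_mpoly set" where
  "bracket_ideal M = Idl\<^bsub>bracket_poly_ring M\<^esub> (bracket_relations M)"

definition bracket_ring :: "'e matroid \<Rightarrow> 'e bracket int_mpoly set ring" where
  "bracket_ring M = bracket_poly_ring M Quot bracket_ideal M"

definition bracket_class :: "'e matroid \<Rightarrow> 'e list \<Rightarrow> 'e bracket int_mpoly set" where
  "bracket_class M Z = bracket_ideal M +>\<^bsub>bracket_poly_ring M\<^esub> br Z"

section \<open>Matrices, minors and cross ratios\<close>

text \<open>The triple \<open>(S, T, A)\<close> is the matrix with rows labelled by \<open>S\<close>, columns labelled by
  \<open>T\<close> and entries \<open>A x y\<close> for \<open>x \<in> S\<close>, \<open>y \<in> T\<close>; other values of \<open>A\<close> are irrelevant.\<close>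

type_synonym ('e, 'a) lmatrix = "'e set \<times> 'e set \<times> ('e \<Rightarrow> 'e \<Rightarrow> 'a)"

definition representation_matrix ::
  "'e matroid \<Rightarrow> 'e list \<Rightarrow> ('e, 'e bracket int_mpoly set) lmatrix" where
  "representation_matrix M B = (set B, ground M - set B,
     \<lambda>u v. bracket_class M (map (\<lambda>x. if x = u then v else x) B)
             \<otimes>\<^bsub>bracket_ring M\<^esub> inv\<^bsub>bracket_ring M\<^esub> (bracket_class M B))"

definition pivot :: "'a ring \<Rightarrow> 'e \<Rightarrow> 'e \<Rightarrow> ('e, 'a) lmatrix \<Rightarrow> ('e, 'a) lmatrix" where
  "pivot R x y = (\<lambda>(S, T, A). (insert y (S - {x}), insert x (T - {y}),
     \<lambda>u v. if u = y \<and> v = x then inv\<^bsub>R\<^esub> (A x y)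
           else if u = y then inv\<^bsub>R\<^esub> (A x y) \<otimes>\<^bsub>R\<^esub> A x v
           else if v = x then \<ominus>\<^bsub>R\<^esub> (inv\<^bsub>R\<^esub> (A x y) \<otimes>\<^bsub>R\<^esub> A u y)
           else A u v \<ominus>\<^bsub>R\<^esub> (inv\<^bsub>R\<^esub> (A x y) \<otimes>\<^bsub>R\<^esub> A u y \<otimes>\<^bsub>R\<^esub> A x v)))"

text \<open>\<open>matrix_minor R A A'\<close> is \<open>A' \<preceq> A\<close>, over the ring \<open>R\<close>. A permutation here moves the
  entries and keeps the labels in place. If the labels move along with the entries, the
  triple does not change.\<close>

inductive matrix_minor :: "'a ring \<Rightarrow> ('e, 'a) lmatrix \<Rightarrow> ('e, 'a) lmatrix \<Rightarrow> bool"
  for R :: "'a ring" and A :: "('e, 'a) lmatrix" where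
  refl: "matrix_minor R A A"
| scale_row: "matrix_minor R A (S, T, D) \<Longrightarrow> x \<in> S \<Longrightarrow> c \<in> Units R \<Longrightarrow>
    matrix_minor R A (S, T, \<lambda>u v. if u = x then c \<otimes>\<^bsub>R\<^esub> D u v else D u v)"
| scale_col: "matrix_minor R A (S, T, D) \<Longrightarrow> y \<in> T \<Longrightarrow> c \<in> Units R \<Longrightarrow>
    matrix_minor R A (S, T, \<lambda>u v. if v = y then c \<otimes>\<^bsub>R\<^esub> D u v else D u v)"
| delete_row: "matrix_minor R A (S, T, D) \<Longrightarrow> x \<in> S \<Longrightarrow> matrix_minor R A (S - {x}, T, D)"
| delete_col: "matrix_minor R A (S, T, D) \<Longrightarrow> y \<in> T \<Longrightarrow> matrix_minor R A (S, T - {y}, D)"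
| permute_rows: "matrix_minor R A (S, T, D) \<Longrightarrow> \<pi> permutes S \<Longrightarrow>
    matrix_minor R A (S, T, \<lambda>u v. D (\<pi> u) v)"
| permute_cols: "matrix_minor R A (S, T, D) \<Longrightarrow> \<pi> permutes T \<Longrightarrow>
    matrix_minor R A (S, T, \<lambda>u v. D u (\<pi> v))"
| pivot: "matrix_minor R A (S, T, D) \<Longrightarrow> x \<in> S \<Longrightarrow> y \<in> T \<Longrightarrow> D x y \<noteq> \<zero>\<^bsub>R\<^esub> \<Longrightarrow>
    matrix_minor R A (pivot R x y (S, T, D))"

text \<open>The unlabelled \<open>2 \<times> 2\<close> matrix with rows \<open>(1, 1)\<close> and \<open>(p, 1)\<close> may carry any row labels
  \<open>x1, x2\<close> and any column labels \<open>y1, y2\<close>.\<close>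

definition cross_ratios :: "'a ring \<Rightarrow> ('e, 'a) lmatrix \<Rightarrow> 'a set" where
  "cross_ratios R A = {p. \<exists>x1 x2 y1 y2 D. x1 \<noteq> x2 \<and> y1 \<noteq> y2 \<and>
     matrix_minor R A ({x1, x2}, {y1, y2}, D) \<and>
     D x1 y1 = \<one>\<^bsub>R\<^esub> \<and> D x1 y2 = \<one>\<^bsub>R\<^esub> \<and> D x2 y1 = p \<and> D x2 y2 = \<one>\<^bsub>R\<^esub>}"

text \<open>The cross ratios of \<open>M\<close> do not depend on the chosen ordered basis.\<close>

definition matroid_cross_ratios :: "'e matroid \<Rightarrow> 'e bracket int_mpoly set set" where
  "matroid_cross_ratios M =
     cross_ratios (bracket_ring M) (representation_matrix M (SOME B. B \<in> basis_tuples M))"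

section \<open>The universal partial field\<close>

definition universal_ring :: "'e matroid \<Rightarrow> 'e bracket int_mpoly set ring" where
  "universal_ring M =
     (bracket_ring M) \<lparr>carrier := generate_ring (bracket_ring M) (matroid_cross_ratios M)\<rparr>"

definition universal_partial_field :: "'e matroid \<Rightarrow> 'e bracket int_mpoly set pfield" where
  "universal_partial_field M = (let R = universal_ring M in
     (R, generate (units_of R) ((matroid_cross_ratios M \<union> {\<ominus>\<^bsub>R\<^esub> \<one>\<^bsub>R\<^esub>}) - {\<zero>\<^bsub>R\<^esub>})))"

section \<open>Restrictions of the projective plane\<close>

type_synonym 'f pg_point = "('f ^ 3) set"

definition pg_points :: "('f :: field) pg_point set" where
  "pg_points = {P. vec.subspace P \<and> vec.dim P = 1}"

text \<open>A line is the set of points on it, that is, the points contained in some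
  two-dimensional subspace.\<close>

definition pg_lines :: "('f :: field) pg_point set set" where
  "pg_lines = {{P \<in> pg_points. P \<subseteq> W} | W. vec.subspace W \<and> vec.dim W = 2}"

definition pg_indep :: "('f :: field) pg_point set \<Rightarrow> bool" where
  "pg_indep I \<longleftrightarrow> I \<subseteq> pg_points \<and> finite I \<and> vec.dim (\<Union>I) = card I"

definition pg_restriction :: "('f :: field) pg_point set \<Rightarrow> 'f pg_point matroid" where
  "pg_restriction E =
     (E, {B. B \<subseteq> E \<and> pg_indep B \<and> (\<forall>I. I \<subseteq> E \<and> pg_indep I \<and> B \<subseteq> I \<longrightarrow> I = B)})"

definition Q_matroid ::
  "('f :: field) pg_point set \<Rightarrow> 'f pg_point set \<Rightarrow> 'f pg_point set \<Rightarrow> 'f pg_point matroid" where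
  "Q_matroid L1 L2 L3 = pg_restriction (L1 \<union> L2 \<union> L3)"

definition Q_plus_matroid ::
  "('f :: field) pg_point set \<Rightarrow> 'f pg_point set \<Rightarrow> 'f pg_point set \<Rightarrow> 'f pg_point \<Rightarrow>
     'f pg_point matroid" where
  "Q_plus_matroid L1 L2 L3 e = pg_restriction (insert e (ground (Q_matroid L1 L2 L3)))"

lemma dim_Un_point:
  fixes P :: "('f :: field) pg_point"
  assumes "P \<in> pg_points"
  shows "vec.dim (P \<union> S) = (if P \<subseteq> vec.span S then vec.dim S else vec.dim S + 1)"
proof -
  from assms have sub: "vec.subspace P" and d: "vec.dim P = 1"
    by (auto simp: pg_points_def)
  obtain B where B: "B \<subseteq> P" "vec.independent B" "P \<subseteq> vec.span B" "card B = vec.dim P"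
    using vec.basis_exists by blast
  then obtain v where v: "B = {v}" using d by (auto simp: card_1_singleton_iff)
  have "vec.span P = vec.span {v}"
    by (rule equalityI; rule vec.span_minimal)
       (use B v in \<open>auto simp: vec.span_base\<close>)
  then have "vec.span (P \<union> S) = vec.span (insert v S)"
    using vec.span_Un[of P S] vec.span_Un[of "{v}" S] by simp
  then have *: "vec.dim (P \<union> S) = vec.dim (insert v S)"
    by (rule vec.span_eq_dim)
  have "P \<subseteq> vec.span S \<longleftrightarrow> v \<in> vec.span S"
    using B v vec.span_minimal[of "{v}" "vec.span S"] by blast
  then show ?thesis using * by (simp add: vec.dim_insert)
qed

lemma dim_Union_le_card:
  fixes J :: "('f :: field) pg_point set"
  assumes "finite J" "J \<subseteq> pg_points"
  shows "vec.dim (\<Union>J) \<le> card J"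
  using assms by (induction) (auto simp: dim_Un_point)

lemma pg_indep_subset:
  fixes I :: "('f :: field) pg_point set"
  assumes "pg_indep I" "P \<in> I"
  shows "pg_indep (I - {P})"
proof -
  from assms have I: "finite I" "I \<subseteq> pg_points" "vec.dim (\<Union>I) = card I"
    by (auto simp: pg_indep_def)
  have eq: "\<Union>I = P \<union> \<Union>(I - {P})" using assms(2) by auto
  have "vec.dim (\<Union>(I - {P})) \<le> card (I - {P})"
    using I by (intro dim_Union_le_card) auto
  moreover have "vec.dim (\<Union>I) \<le> vec.dim (\<Union>(I - {P})) + 1"
    unfolding eq using assms I by (subst dim_Un_point) auto
  moreover have "card I = card (I - {P}) + 1"
    using card.remove[OF I(1) assms(2)] by simp
  ultimately show ?thesis using I by (auto simp: pg_indep_def)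
qed

lemma pg_indep_insert:
  fixes I :: "('f :: field) pg_point set"
  assumes "pg_indep I" "P \<in> pg_points" "\<not> P \<subseteq> vec.span (\<Union>I)"
  shows "P \<notin> I" "pg_indep (insert P I)"
proof -
  show "P \<notin> I" using assms(3) vec.span_superset[of "\<Union>I"] by blast
  then show "pg_indep (insert P I)"
    using assms by (auto simp: pg_indep_def dim_Un_point)
qed

lemma pg_indep_card_le:
  fixes I :: "('f :: field) pg_point set"
  assumes "I \<subseteq> E" "pg_indep I"
  shows "card I \<le> vec.dim (\<Union>E)"
  using assms vec.dim_subset[OF Union_mono[OF assms(1)]] by (simp add: pg_indep_def)

lemma bases_pg_restriction:
  fixes E :: "('f :: field) pg_point set"
  assumes "finite E" "E \<subseteq> pg_points"
  shows "bases (pg_restriction E) = {B. B \<subseteq> E \<and> pg_indep B \<and> card B = vec.dim (\<Union>E)}"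
proof (intro Set.set_eqI iffI)
  fix B assume "B \<in> bases (pg_restriction E)"
  then have B: "B \<subseteq> E" "pg_indep B" and
    max: "\<And>I. I \<subseteq> E \<Longrightarrow> pg_indep I \<Longrightarrow> B \<subseteq> I \<Longrightarrow> I = B"
    by (auto simp: pg_restriction_def)
  have "P \<subseteq> vec.span (\<Union>B)" if "P \<in> E" for P
    using pg_indep_insert[OF B(2), of P] max[of "insert P B"] that B assms by blast
  then have "\<Union>E \<subseteq> vec.span (\<Union>B)" by blast
  then have "vec.dim (\<Union>E) \<le> vec.dim (\<Union>B)" by (rule vec.dim_mono)
  then have "card B = vec.dim (\<Union>E)"
    using pg_indep_card_le[OF B] B(2) by (simp add: pg_indep_def)
  then show "B \<in> {B. B \<subseteq> E \<and> pg_indep B \<and> card B = vec.dim (\<Union>E)}" using B by simp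
next
  fix B assume "B \<in> {B. B \<subseteq> E \<and> pg_indep B \<and> card B = vec.dim (\<Union>E)}"
  then have B: "B \<subseteq> E" "pg_indep B" "card B = vec.dim (\<Union>E)" by auto
  have "I = B" if "I \<subseteq> E" "pg_indep I" "B \<subseteq> I" for I
    using pg_indep_card_le[OF that(1,2)] that B card_seteq[of I B]
    by (auto simp: pg_indep_def)
  then show "B \<in> bases (pg_restriction E)" using B by (auto simp: pg_restriction_def)
qed

theorem is_matroid_pg_restriction:
  fixes E :: "('f :: field) pg_point set"
  assumes fin: "finite E" and E: "E \<subseteq> pg_points"
  shows "is_matroid (pg_restriction E)"
proof -
  have "bases (pg_restriction E) \<noteq> {}"
  proof -
    let ?S = "{I. I \<subseteq> E \<and> pg_indep I}"
    have "finite ?S" using fin by simp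
    moreover have "?S \<noteq> {}"
    proof -
      have "{} \<in> ?S" by (simp add: pg_indep_def)
      then show ?thesis by (metis empty_iff)
    qed
    ultimately have "\<exists>B\<in>?S. \<forall>I\<in>?S. B \<subseteq> I \<longrightarrow> B = I" by (rule finite_has_maximal)
    then obtain B where B: "B \<in> ?S" and max: "\<forall>I\<in>?S. B \<subseteq> I \<longrightarrow> B = I" by (elim bexE)
    have "I = B" if "I \<subseteq> E \<and> pg_indep I \<and> B \<subseteq> I" for I
      using max that by blast
    then have "B \<in> bases (pg_restriction E)"
      using B by (simp add: pg_restriction_def)
    then show ?thesis by auto
  qed
  moreover have "\<exists>y\<in>B2 - B1. insert y (B1 - {x}) \<in> bases (pg_restriction E)"
    if B1: "B1 \<in> bases (pg_restriction E)" and B2: "B2 \<in> bases (pg_restriction E)"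
      and x: "x \<in> B1 - B2" for B1 B2 x
  proof -
    have B: "B1 \<subseteq> E" "pg_indep B1" "card B1 = vec.dim (\<Union>E)"
            "B2 \<subseteq> E" "pg_indep B2" "card B2 = vec.dim (\<Union>E)"
      using B1 B2 unfolding bases_pg_restriction[OF fin E] by simp_all
    let ?C = "B1 - {x}"
    have C: "pg_indep ?C" using pg_indep_subset[OF B(2)] x by simp
    have c: "card B1 = card ?C + 1"
      using card.remove[of B1 x] B(2) x by (simp add: pg_indep_def)
    have "\<exists>y\<in>B2. \<not> y \<subseteq> vec.span (\<Union>?C)"
    proof (rule ccontr)
      assume "\<not> ?thesis"
      then have "\<Union>B2 \<subseteq> vec.span (\<Union>?C)" by blast
      then have "vec.dim (\<Union>B2) \<le> vec.dim (\<Union>?C)" by (rule vec.dim_mono)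
      moreover have "vec.dim (\<Union>B2) = card B2" "vec.dim (\<Union>?C) = card ?C"
        using B(5) C by (simp_all add: pg_indep_def)
      ultimately show False using B(3,6) c by linarith
    qed
    then obtain y where y: "y \<in> B2" "\<not> y \<subseteq> vec.span (\<Union>?C)" by blast
    have yP: "y \<in> pg_points" using y(1) B(4) E by blast
    note ins = pg_indep_insert[OF C yP y(2)]
    have "finite ?C" using C by (simp add: pg_indep_def)
    then have "card (insert y ?C) = card ?C + 1" using ins(1) by (simp del: insert_Diff_single)
    then have "card (insert y ?C) = vec.dim (\<Union>E)" using c B(3) by simp
    then have "insert y ?C \<in> bases (pg_restriction E)"
      unfolding bases_pg_restriction[OF fin E] using ins(2) y(1) B(1,4) by blast
    moreover have "y \<notin> B1" using ins(1) x y(1) by blast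
    ultimately show ?thesis using y(1) by blast
  qed
  ultimately show ?thesis
    using fin unfolding is_matroid_def by (auto simp: pg_restriction_def)
qed

end

theory Submission
  imports Defs
begin

text \<open>
  Choose the three intersection points of the lines together with \<open>e\<close> as a projective frame.
  After rescaling the points by units of the bracket ring, the brackets of this frame equal 1 and
  every point \<open>(1, a, 0)\<close> has a single unknown bracket \<open>\<theta> a\<close>. The collinearities
  \<open>(1, a, 0), (0, 1, d), (1, 0, - a d)\<close> make \<open>\<theta>\<close> multiplicative, and the collinearities of
  \<open>(1, 1, 1)\<close> with points on two of the lines give \<open>\<theta> (1 - a) = 1 - \<theta> a\<close>, so \<open>\<theta>\<close> is a ring
  homomorphism from \<open>GF(q)\<close> to the bracket ring. The Pluecker relations then
  express every bracket as the image of a determinant over \<open>GF(q)\<close>, up to the scaling, so every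
  cross ratio lies in the image of \<open>\<theta>\<close>. Conversely, the submatrix on the rows \<open>(1, 0, 0)\<close>,
  \<open>(0, 1, 0)\<close> and the columns \<open>(1, p, 0)\<close>, \<open>(1, 1, 0)\<close> exhibits \<open>\<theta> p\<close> as a cross ratio. Evaluating
  brackets as determinants over \<open>GF(q)\<close> shows that the bracket ring is nonzero; hence \<open>\<theta>\<close> is injective.
\<close>

text \<open>Brackets depend on a scale for each point, and only cross ratios do not; this is why
  \<open>coordinatization\<close> carries a constant unit and a unit for every point. The point
  \<open>e\<close> has two tasks: it fixes the relative scale of the three corners, and it supplies
  addition, since collinear triples with one point on each of the three lines are of Menelaus type
  and involve products only.

  The other obstacle is that cross ratios come from arbitrary sequences of scalings, permutations,
  deletions and pivots, starting at a basis that is merely some choice. They are never enumerated.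
  For the upper bound it suffices that the shape "diagonal times image of a field matrix times
  diagonal" survives every operation. For the lower bound the matrix must also remember the vectors
  that its labels stand for, so that it can be pivoted to the frame, where the entries are plain
  coordinates.\<close>

lemma ring_of_type_algebra_simps [simp]:
  "carrier (ring_of_type_algebra :: 'a ring) = UNIV"
  "x \<otimes>\<^bsub>ring_of_type_algebra\<^esub> y = x * y"
  "x \<oplus>\<^bsub>ring_of_type_algebra\<^esub> y = x + y"
  "\<one>\<^bsub>ring_of_type_algebra\<^esub> = (1 :: 'a)"
  "\<zero>\<^bsub>ring_of_type_algebra\<^esub> = (0 :: 'a)"
  for x y :: "'a::comm_ring_1"
  by (simp_all add: ring_of_type_algebra_def)

lemma (in cring) ring_hom_field_Units:
  fixes h :: "'f::field \<Rightarrow> 'a"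
  assumes h: "h \<in> ring_hom ring_of_type_algebra R" and a: "a \<noteq> 0"
  shows "h a \<in> Units R"
proof -
  have "h a \<otimes> h (1 / a) = \<one>"
    using ring_hom_mult[OF h, of a "1 / a"] ring_hom_one[OF h] a by simp
  then show ?thesis
    using ring_hom_closed[OF h, of a] ring_hom_closed[OF h, of "1 / a"]
    by (auto simp: Units_def m_comm intro!: bexI[of _ "h (1 / a)"])
qed

section \<open>Brackets on a frame of the projective plane\<close>

type_synonym 'f triple = "'f \<times> 'f \<times> 'f"

fun det3 :: "'f::comm_ring_1 triple \<Rightarrow> 'f triple \<Rightarrow> 'f triple \<Rightarrow> 'f" where
  "det3 (x1, x2, x3) (y1, y2, y3) (z1, z2, z3) =
     z1 * (x2 * y3 - x3 * y2) + z2 * (x3 * y1 - x1 * y3) + z3 * (x1 * y2 - x2 * y1)"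

text \<open>The three-term Pluecker identity, arranged like relation (3) of the bracket ideal, so
  that determinants can be substituted for brackets.\<close>

lemma det3_plucker:
  "det3 x1 x2 w * det3 y1 y2 w = det3 y1 x2 w * det3 x1 y2 w + det3 y2 x2 w * det3 y1 x1 w"
  by (cases x1; cases x2; cases y1; cases y2; cases w) (simp add: algebra_simps)

lemma det3_swap:
  "det3 y x z = - det3 x y z" "det3 x z y = - det3 x y z" "det3 z y x = - det3 x y z"
  by (cases x; cases y; cases z; simp add: algebra_simps)+

lemma det3_eq: "det3 x x y = 0" "det3 x y x = 0" "det3 y x x = 0"
  by (cases x; cases y; simp add: algebra_simps)+

text \<open>Splits an arbitrary transposition of three positions into concrete ones that
  simplification can evaluate.\<close>

lemma transpose_less_3_cases:
  assumes "a < (3::nat)" "c < (3::nat)"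
  obtains "a = 0" "c = 0" | "a = 0" "c = 1" | "a = 0" "c = 2" | "a = 1" "c = 0" | "a = 1" "c = 1"
    | "a = 1" "c = 2" | "a = 2" "c = 0" | "a = 2" "c = 1" | "a = 2" "c = 2"
  using assms by (auto simp: numeral_3_eq_3 less_Suc_eq numeral_2_eq_2)

text \<open>Transpositions are split off on the argument side of \<sigma>, so each step exchanges
  two of the three vectors \<open>f (p i)\<close> and \<open>det3_swap\<close> supplies the
  sign.\<close>

lemma det3_permute:
  assumes "\<sigma> permutes {..<3}"
  shows "det3 (f (\<sigma> 0)) (f (\<sigma> 1)) (f (\<sigma> 2)) = of_int (sign \<sigma>) * det3 (f 0) (f 1) (f (2::nat))"
  using finite_lessThan assms
proof (induction \<sigma> rule: permutes_rev_induct)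
  case id
  then show ?case by (simp add: sign_id)
next
  case (swap a c p)
  have a: "Transposition.transpose a c permutes {..<3}" using swap by (intro permutes_swap_id)
  have perms: "permutation (Transposition.transpose a c)" "permutation p"
    using a swap by (auto intro: permutation_permutes[THEN iffD2])
  have "sign (p \<circ> Transposition.transpose a c) = sign p * sign (Transposition.transpose a c)"
    by (rule sign_compose[OF perms(2,1)])
  moreover have "a < 3" "c < 3" using swap by auto
  then have "det3 (f (p (Transposition.transpose a c 0))) (f (p (Transposition.transpose a c 1)))
      (f (p (Transposition.transpose a c 2))) = - det3 (f (p 0)) (f (p 1)) (f (p 2))"
    by (rule transpose_less_3_cases)
      (use swap(3) in \<open>auto simp: det3_swap[where x = "f (p 0)" and y = "f (p (Suc 0))" and z = "f (p 2)"]
        Transposition.transpose_def simp del: det3.simps\<close>)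
  ultimately show ?case
    using swap by (simp add: sign_swap_id o_def)
qed

section \<open>The standard frame and functions satisfying the bracket axioms on it\<close>

abbreviation E1 :: "'f::zero_neq_one triple" where "E1 \<equiv> (1, 0, 0)"
abbreviation E2 :: "'f::zero_neq_one triple" where "E2 \<equiv> (0, 1, 0)"
abbreviation E3 :: "'f::zero_neq_one triple" where "E3 \<equiv> (0, 0, 1)"
abbreviation EE :: "'f::zero_neq_one triple" where "EE \<equiv> (1, 1, 1)"

text \<open>Normalized homogeneous coordinates of the points of \<open>Q\<^sub>q\<^sup>+\<close> with respect to the frame formed by
  the intersection points of the three lines and the extra point.\<close>

definition frame_coords :: "'f::zero_neq_one triple set" where
  "frame_coords = (\<Union>a. {(1, a, 0), (1, 0, a), (0, 1, a)}) \<union> {E3, EE}"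

lemma frame_coordsI [simp, intro]:
  "(1, a, 0) \<in> frame_coords" "(1, 0, a) \<in> frame_coords" "(0, 1, a) \<in> frame_coords"
  "E3 \<in> frame_coords" "EE \<in> frame_coords"
  by (auto simp: frame_coords_def)

lemma frame_coordsE:
  assumes "x \<in> frame_coords"
  obtains a where "x = (1, a, 0)" | a where "x = (1, 0, a)" | a where "x = (0, 1, a)"
    | "x = E3" | "x = EE"
  using assms by (auto simp: frame_coords_def)

text \<open>Isolates what is used of the brackets of the matroid, with bases expressed by
  \<open>det3\<close>. The axioms are chosen to be stable under rescaling; the actual bracket
  classes are fixed elements, and their rescaled versions are no longer classes of bracket
  symbols.\<close>

locale bracket_function = cring R for R (structure) +
  fixes b :: "'f::field triple \<Rightarrow> 'f triple \<Rightarrow> 'f triple \<Rightarrow> 'a"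
  assumes closed: "\<lbrakk>x \<in> frame_coords; y \<in> frame_coords; z \<in> frame_coords\<rbrakk> \<Longrightarrow> b x y z \<in> carrier R"
    and dependent: "\<lbrakk>x \<in> frame_coords; y \<in> frame_coords; z \<in> frame_coords; det3 x y z = 0\<rbrakk>
      \<Longrightarrow> b x y z = \<zero>"
    and unit: "\<lbrakk>x \<in> frame_coords; y \<in> frame_coords; z \<in> frame_coords; det3 x y z \<noteq> 0\<rbrakk>
      \<Longrightarrow> b x y z \<in> Units R"
    and swap12: "\<lbrakk>x \<in> frame_coords; y \<in> frame_coords; z \<in> frame_coords\<rbrakk>
      \<Longrightarrow> b y x z = \<ominus> b x y z"
    and swap23: "\<lbrakk>x \<in> frame_coords; y \<in> frame_coords; z \<in> frame_coords\<rbrakk>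
      \<Longrightarrow> b x z y = \<ominus> b x y z"
    and plucker: "\<lbrakk>x1 \<in> frame_coords; x2 \<in> frame_coords; y1 \<in> frame_coords; y2 \<in> frame_coords;
        w \<in> frame_coords\<rbrakk>
      \<Longrightarrow> b x1 x2 w \<otimes> b y1 y2 w = b y1 x2 w \<otimes> b x1 y2 w \<oplus> b y2 x2 w \<otimes> b y1 x1 w"
begin

lemma cyclic:
  assumes "x \<in> frame_coords" "y \<in> frame_coords" "z \<in> frame_coords"
  shows "b y z x = b x y z"
  by (simp add: swap12[of x y z] swap23[of y x z] assms closed)

text \<open>All three products in the Pluecker relation contain the same points \<open>x1\<close>,
  \<open>x2\<close>, \<open>y1\<close>, \<open>y2\<close> and twice \<open>w\<close>, so the scaling
  contributes one common factor.\<close>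

lemma scaled:
  assumes c: "c \<in> Units R" and s: "\<And>x. x \<in> frame_coords \<Longrightarrow> s x \<in> Units R"
  shows "bracket_function R (\<lambda>x y z. c \<otimes> s x \<otimes> s y \<otimes> s z \<otimes> b x y z)"
proof unfold_locales
  note [simp] = Units_closed[OF c] s closed Units_closed[OF s]
  fix x y z :: "'f triple" assume K: "x \<in> frame_coords" "y \<in> frame_coords" "z \<in> frame_coords"
  note [simp] = K
  show "c \<otimes> s x \<otimes> s y \<otimes> s z \<otimes> b x y z \<in> carrier R" by simp
  show "c \<otimes> s x \<otimes> s y \<otimes> s z \<otimes> b x y z = \<zero>" if "det3 x y z = 0"
    using dependent[OF K that] by simp
  show "c \<otimes> s x \<otimes> s y \<otimes> s z \<otimes> b x y z \<in> Units R" if "det3 x y z \<noteq> 0"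
    using unit[OF K that] c by simp
  show "c \<otimes> s y \<otimes> s x \<otimes> s z \<otimes> b y x z = \<ominus> (c \<otimes> s x \<otimes> s y \<otimes> s z \<otimes> b x y z)"
    unfolding swap12[OF K] by (simp add: r_minus m_ac)
  show "c \<otimes> s x \<otimes> s z \<otimes> s y \<otimes> b x z y = \<ominus> (c \<otimes> s x \<otimes> s y \<otimes> s z \<otimes> b x y z)"
    unfolding swap23[OF K] by (simp add: r_minus m_ac)
next
  note [simp] = Units_closed[OF c] s closed Units_closed[OF s]
  fix x1 x2 y1 y2 w :: "'f triple"
  assume K: "x1 \<in> frame_coords" "x2 \<in> frame_coords" "y1 \<in> frame_coords" "y2 \<in> frame_coords"
    "w \<in> frame_coords"
  note [simp] = K
  let ?d = "c \<otimes> s x1 \<otimes> s x2 \<otimes> s w \<otimes> (c \<otimes> s y1 \<otimes> s y2 \<otimes> s w)"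
  have "c \<otimes> s x1 \<otimes> s x2 \<otimes> s w \<otimes> b x1 x2 w \<otimes> (c \<otimes> s y1 \<otimes> s y2 \<otimes> s w \<otimes> b y1 y2 w) =
    ?d \<otimes> (b x1 x2 w \<otimes> b y1 y2 w)"
    by (simp add: m_ac)
  also have "\<dots> = ?d \<otimes> (b y1 x2 w \<otimes> b x1 y2 w) \<oplus> ?d \<otimes> (b y2 x2 w \<otimes> b y1 x1 w)"
    by (simp add: plucker[OF K] r_distr)
  also have "\<dots> = c \<otimes> s y1 \<otimes> s x2 \<otimes> s w \<otimes> b y1 x2 w \<otimes> (c \<otimes> s x1 \<otimes> s y2 \<otimes> s w \<otimes> b x1 y2 w) \<oplus>
       c \<otimes> s y2 \<otimes> s x2 \<otimes> s w \<otimes> b y2 x2 w \<otimes> (c \<otimes> s y1 \<otimes> s x1 \<otimes> s w \<otimes> b y1 x1 w)"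
    by (simp add: m_ac)
  finally show "c \<otimes> s x1 \<otimes> s x2 \<otimes> s w \<otimes> b x1 x2 w \<otimes> (c \<otimes> s y1 \<otimes> s y2 \<otimes> s w \<otimes> b y1 y2 w) =
       c \<otimes> s y1 \<otimes> s x2 \<otimes> s w \<otimes> b y1 x2 w \<otimes> (c \<otimes> s x1 \<otimes> s y2 \<otimes> s w \<otimes> b x1 y2 w) \<oplus>
       c \<otimes> s y2 \<otimes> s x2 \<otimes> s w \<otimes> b y2 x2 w \<otimes> (c \<otimes> s y1 \<otimes> s x1 \<otimes> s w \<otimes> b y1 x1 w)" .
qed

end

text \<open>The prescribed values are those that \<open>det3\<close> takes on the same triples. The
  first four tie down the frame, the others fix the scale of each remaining point by its first
  nonzero coordinate.\<close>

locale normalized_bracket_function = bracket_function +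
  assumes frame: "b E1 E2 E3 = \<one>"
    "b EE E2 E3 = \<one>" "b E1 EE E3 = \<one>" "b E1 E2 EE = \<one>"
    and leading: "b (1, a, 0) E2 E3 = \<one>" "b (1, 0, a) E2 E3 = \<one>" "b E1 (0, 1, a) E3 = \<one>"
begin

text \<open>By Cramer's rule these are the candidates for the three homogeneous coordinates of
  \<open>x\<close>, now with values in the ring.\<close>

definition c1 where "c1 x = b x E2 E3"
definition c2 where "c2 x = b E1 x E3"
definition c3 where "c3 x = b E1 E2 x"

lemma c_closed [simp]:
  assumes "x \<in> frame_coords"
  shows "c1 x \<in> carrier R" "c2 x \<in> carrier R" "c3 x \<in> carrier R"
  using assms by (auto simp: c1_def c2_def c3_def closed)

lemma c_values:
  "c1 (1, a, 0) = \<one>" "c3 (1, a, 0) = \<zero>"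
  "c1 (1, 0, a) = \<one>" "c2 (1, 0, a) = \<zero>"
  "c1 (0, 1, a) = \<zero>" "c2 (0, 1, a) = \<one>"
  "c1 E3 = \<zero>" "c2 E3 = \<zero>" "c3 E3 = \<one>"
  "c1 EE = \<one>" "c2 EE = \<one>" "c3 EE = \<one>" "c2 E1 = \<zero>" "c3 E2 = \<zero>"
  unfolding c1_def c2_def c3_def using frame leading by (auto intro!: dependent)

text \<open>The factor \<open>b E2 E3 E1\<close>, which is one, is inserted so that the Pluecker
  relation with common point \<open>E1\<close> applies; every bracket that it produces contains two
  corners. The other two corners work alike.\<close>

lemma bracket_E1:
  assumes [simp]: "x \<in> frame_coords" "y \<in> frame_coords"
  shows "b E1 x y = c2 x \<otimes> c3 y \<ominus> c3 x \<otimes> c2 y"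
proof -
  have "b E1 x y = b x y E1 \<otimes> b E2 E3 E1"
    by (simp add: cyclic[of E1] frame closed)
  also have "\<dots> = b E2 y E1 \<otimes> b x E3 E1 \<oplus> b E3 y E1 \<otimes> b E2 x E1"
    by (rule plucker) auto
  also have "\<dots> = c3 y \<otimes> c2 x \<oplus> (\<ominus> c2 y) \<otimes> c3 x"
    unfolding c2_def c3_def by (simp add: cyclic[of E1] swap23[of E1 _ E3, symmetric])
  finally show ?thesis by (simp add: m_comm r_minus minus_eq)
qed

lemma bracket_E2:
  assumes [simp]: "x \<in> frame_coords" "y \<in> frame_coords"
  shows "b E2 x y = c3 x \<otimes> c1 y \<ominus> c1 x \<otimes> c3 y"
proof -
  have 1: "b E3 E1 E2 = \<one>" using cyclic[of E2 E3 E1] cyclic[of E1 E2 E3] frame by simp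
  have "b E2 x y = b x y E2 \<otimes> b E3 E1 E2"
    by (simp add: cyclic[of E2] 1 closed)
  also have "\<dots> = b E3 y E2 \<otimes> b x E1 E2 \<oplus> b E1 y E2 \<otimes> b E3 x E2"
    by (rule plucker) auto
  also have "\<dots> = c1 y \<otimes> c3 x \<oplus> (\<ominus> c3 y) \<otimes> c1 x"
    unfolding c1_def c3_def
    by (simp add: cyclic[of _ E1 E2, symmetric] cyclic[of _ E2 E3] cyclic[of E2 E3]
        cyclic[of E3 _ E2, symmetric]
        swap23[of E1 E2])
  finally show ?thesis by (simp add: m_comm r_minus minus_eq)
qed

lemma bracket_E3:
  assumes [simp]: "x \<in> frame_coords" "y \<in> frame_coords"
  shows "b E3 x y = c1 x \<otimes> c2 y \<ominus> c2 x \<otimes> c1 y"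
proof -
  have "b E3 x y = b x y E3 \<otimes> b E1 E2 E3"
    by (simp add: cyclic[of E3] frame closed)
  also have "\<dots> = b E1 y E3 \<otimes> b x E2 E3 \<oplus> b E2 y E3 \<otimes> b E1 x E3"
    by (rule plucker) auto
  also have "\<dots> = c2 y \<otimes> c1 x \<oplus> (\<ominus> c1 y) \<otimes> c2 x"
    unfolding c1_def c2_def
    by (simp add: swap12[of _ E2 E3])
  finally show ?thesis by (simp add: m_comm r_minus minus_eq)
qed

text \<open>Again the Pluecker relation, but with common point \<open>z\<close>: the auxiliary
  bracket is now a coordinate of \<open>z\<close> instead of one, so a general bracket is reached
  only up to that factor.\<close>

lemma expand:
  assumes [simp]: "x \<in> frame_coords" "y \<in> frame_coords" "z \<in> frame_coords"
  shows "b x y z \<otimes> c1 z = b E3 y z \<otimes> b E2 x z \<ominus> b E2 y z \<otimes> b E3 x z"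
    and "b x y z \<otimes> c2 z = b E1 y z \<otimes> b E3 x z \<ominus> b E3 y z \<otimes> b E1 x z"
    and "b x y z \<otimes> c3 z = b E2 y z \<otimes> b E1 x z \<ominus> b E1 y z \<otimes> b E2 x z"
proof -
  have *: "b x y z \<otimes> b u v z = b v y z \<otimes> b u x z \<ominus> b u y z \<otimes> b v x z"
    if [simp]: "u \<in> frame_coords" "v \<in> frame_coords" for u v
    by (simp add: plucker[of x y u v z] swap12[of v x z] closed r_minus minus_eq a_comm)
  have **: "b E2 E3 z = c1 z" "b E3 E1 z = c2 z" "b E1 E2 z = c3 z"
    by (simp_all add: c1_def c2_def c3_def cyclic[of E3 E1 z, symmetric] cyclic[of z E2 E3])
  show "b x y z \<otimes> c1 z = b E3 y z \<otimes> b E2 x z \<ominus> b E2 y z \<otimes> b E3 x z"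
    and "b x y z \<otimes> c2 z = b E1 y z \<otimes> b E3 x z \<ominus> b E3 y z \<otimes> b E1 x z"
    and "b x y z \<otimes> c3 z = b E2 y z \<otimes> b E1 x z \<ominus> b E1 y z \<otimes> b E2 x z"
    using *[of E2 E3] *[of E3 E1] *[of E1 E2] by (simp_all add: **)
qed

section \<open>The homomorphism from the field to the ring\<close>

definition \<theta> where "\<theta> a = c2 (1, a, 0)"

lemma \<theta>_closed [simp]: "\<theta> a \<in> carrier R"
  by (simp add: \<theta>_def)

lemma \<theta>_zero: "\<theta> 0 = \<zero>"
  by (simp add: \<theta>_def c_values)

text \<open>The points \<open>(1, a, 0)\<close>, \<open>(0, 1, d)\<close> and \<open>(1, 0, - a d)\<close> are collinear.\<close>

lemma menelaus: "c3 (1, 0, - (a * d)) = \<ominus> (\<theta> a \<otimes> c3 (0, 1, d))"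
proof -
  \<comment> \<open>The last point has \<open>c1\<close> equal to one, so the expansion can be read
    off without cancelling anything.\<close>
  have "b (1, a, 0) (0, 1, d) (1, 0, - (a * d)) \<otimes> c1 (1, 0, - (a * d)) = \<zero>"
    by (simp add: dependent)
  then have "c3 (1, 0, - (a * d)) \<oplus> \<theta> a \<otimes> c3 (0, 1, d) = \<zero>"
    unfolding expand(1)[OF frame_coordsI(1,3,2)]
    by (simp add: bracket_E2 bracket_E3 c_values \<theta>_def[symmetric] minus_eq l_minus r_minus m_comm)
  then show ?thesis
    by (metis \<theta>_closed c_closed(3) frame_coordsI(2,3) m_closed minus_equality)
qed

text \<open>Each of these points lies on the line joining \<open>EE\<close> to a corner. This is
  where the extra point of the matroid enters.\<close>

lemma c_one: "\<theta> 1 = \<one>" "c3 (0, 1, 1) = \<one>" "c3 (1, 0, 1) = \<one>"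
proof -
  have "b E3 (1, 1, 0) EE = \<zero>" by (simp add: dependent)
  then show "\<theta> 1 = \<one>" by (simp add: bracket_E3 c_values \<theta>_def)
  have "b E1 (0, 1, 1) EE = \<zero>" by (simp add: dependent)
  then show "c3 (0, 1, 1) = \<one>" by (simp add: bracket_E1 c_values)
  have "b E2 (1, 0, 1) EE = \<zero>" by (simp add: dependent)
  then show "c3 (1, 0, 1) = \<one>" by (simp add: bracket_E2 c_values)
qed

text \<open>\<open>menelaus\<close> at \<open>(1, a)\<close> and at \<open>(a, 1)\<close> computes
  the same bracket of \<open>(1, 0, - a)\<close> twice. Thus the three unknown functions, one for
  each line, reduce to one.\<close>

lemma c3_eq: "c3 (0, 1, a) = \<theta> a" "c3 (1, 0, - a) = \<ominus> \<theta> a"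
proof -
  have "\<ominus> c3 (0, 1, a) = \<ominus> \<theta> a"
    using menelaus[of 1 a] menelaus[of a 1] by (simp add: c_one)
  then show "c3 (0, 1, a) = \<theta> a"
    by (metis \<theta>_closed c_closed(3) frame_coordsI(3) minus_minus)
  show "c3 (1, 0, - a) = \<ominus> \<theta> a"
    using menelaus[of a 1] by (simp add: c_one)
qed

lemma \<theta>_mult: "\<theta> (a * d) = \<theta> a \<otimes> \<theta> d"
proof -
  have "\<ominus> \<theta> (a * d) = \<ominus> (\<theta> a \<otimes> \<theta> d)"
    using menelaus[of a d] by (simp add: c3_eq)
  then show ?thesis
    by (metis \<theta>_closed m_closed minus_minus)
qed

text \<open>Multiplicativity alone would only make \<open>\<theta> (- 1)\<close> a square root of
  one. The sign comes from \<open>(1, 0, 1)\<close>, whose bracket is one by its collinearity with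
  \<open>EE\<close> and \<open>E2\<close>.\<close>

lemma \<theta>_uminus: "\<theta> (- a) = \<ominus> \<theta> a"
proof -
  have "\<theta> (- 1) = \<ominus> \<one>"
    using c3_eq(2)[of "- 1"] by (simp add: c_one)
  then show ?thesis
    using \<theta>_mult[of "- 1" a] by (simp add: l_minus)
qed

text \<open>For \<open>d = 1 / (1 - a)\<close> the points \<open>(1, a, 0)\<close>, \<open>(0, 1, d)\<close> and \<open>(1, 1, 1)\<close> are collinear.\<close>

lemma \<theta>_one_minus: "\<theta> (1 - a) = \<one> \<ominus> \<theta> a"
proof (cases "a = 1")
  case True
  then show ?thesis by (simp add: \<theta>_zero c_one minus_eq r_neg)
next
  case False
  define d where "d = 1 / (1 - a)"
  have ad: "d * (1 - a) = 1" using False by (simp add: d_def)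
  then have "b (1, a, 0) (0, 1, d) EE \<otimes> c1 EE = \<zero>"
    by (simp add: dependent algebra_simps)
  then have "\<one> \<ominus> \<theta> d \<otimes> (\<one> \<ominus> \<theta> a) = \<zero>"
    unfolding expand(1)[OF frame_coordsI(1,3,5)]
    by (simp add: bracket_E2 bracket_E3 c_values \<theta>_def[symmetric] c3_eq minus_eq l_minus r_minus)
  then have "\<theta> d \<otimes> (\<one> \<ominus> \<theta> a) = \<one>"
    by simp
  moreover have "\<theta> (1 - a) \<otimes> \<theta> d = \<one>"
    using \<theta>_mult[of "1 - a" d] ad by (simp add: mult.commute c_one)
  \<comment> \<open>Both sides of the claim are inverse to \<open>\<theta> d\<close>.\<close>
  ultimately show ?thesis
    by (metis \<theta>_closed inv_unique minus_closed one_closed)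
qed

lemma \<theta>_add: "\<theta> (a + d) = \<theta> a \<oplus> \<theta> d"
proof (cases "a = 0")
  case False
  \<comment> \<open>Pulling out \<open>a\<close> turns addition into multiplication and the map that
    sends \<open>t\<close> to \<open>1 - t\<close>, both of which \<theta> already respects.\<close>
  have "\<theta> (a + d) = \<theta> (a * (1 - (- (d / a))))"
    using False by (simp add: distrib_left)
  also have "\<dots> = \<theta> a \<otimes> (\<one> \<oplus> \<theta> (d / a))"
    by (simp only: \<theta>_mult \<theta>_one_minus \<theta>_uminus) (simp add: minus_eq)
  also have "\<dots> = \<theta> a \<oplus> \<theta> (a * (d / a))"
    by (simp only: \<theta>_mult) (simp add: r_distr)
  also have "a * (d / a) = d" using False by simp
  finally show ?thesis .
qed (simp add: \<theta>_zero)

lemma \<theta>_ring_hom: "\<theta> \<in> ring_hom ring_of_type_algebra R"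
  by (rule ring_hom_memI) (auto simp: \<theta>_mult \<theta>_add c_one)

lemma \<theta>_diff: "\<theta> (a - d) = \<theta> a \<ominus> \<theta> d"
  using \<theta>_add[of a "- d"] by (simp add: \<theta>_uminus minus_eq)

lemma c_eq_\<theta>:
  assumes "(x1, x2, x3) \<in> frame_coords"
  shows "c1 (x1, x2, x3) = \<theta> x1" "c2 (x1, x2, x3) = \<theta> x2" "c3 (x1, x2, x3) = \<theta> x3"
  using assms c3_eq(2)[of "- x3"]
  by (auto elim!: frame_coordsE simp: c_values c_one \<theta>_zero c3_eq(1) \<theta>_uminus \<theta>_def[symmetric])

lemma \<theta>_unit: "a \<noteq> 0 \<Longrightarrow> \<theta> a \<in> Units R"
  by (rule ring_hom_field_Units[OF \<theta>_ring_hom])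

text \<open>\<open>expand\<close> yields the equation multiplied by \<theta> of any coordinate of
  \<open>z\<close>. Some coordinate is nonzero, and its image is a unit and can be
  cancelled.\<close>

theorem bracket_eq_det3:
  assumes K: "x \<in> frame_coords" "y \<in> frame_coords" "z \<in> frame_coords"
  shows "b x y z = \<theta> (det3 x y z)"
proof -
  obtain x1 x2 x3 y1 y2 y3 z1 z2 z3 where
    xyz [simp]: "x = (x1, x2, x3)" "y = (y1, y2, y3)" "z = (z1, z2, z3)"
    by (metis prod.exhaust)
  note K' = K[unfolded xyz]
  note hom = \<theta>_mult[symmetric] \<theta>_diff[symmetric]
  have pair: "b E1 u v = \<theta> (det3 E1 u v) \<and> b E2 u v = \<theta> (det3 E2 u v) \<and> b E3 u v = \<theta> (det3 E3 u v)"
    if "u \<in> frame_coords" "v \<in> frame_coords" for u v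
    using that by (cases u; cases v)
      (simp add: bracket_E1 bracket_E2 bracket_E3 c_eq_\<theta> hom algebra_simps)
  have cancel: "b x y z = \<theta> (det3 x y z)"
    if "b x y z \<otimes> \<theta> t = \<theta> (det3 x y z * t)" "t \<noteq> 0" for t
    using that \<theta>_unit[OF that(2)] K
    by (metis \<theta>_closed \<theta>_mult closed m_comm Units_l_cancel)
  have e: "b x y z \<otimes> \<theta> z1 = \<theta> (det3 x y z * z1)" "b x y z \<otimes> \<theta> z2 = \<theta> (det3 x y z * z2)"
    "b x y z \<otimes> \<theta> z3 = \<theta> (det3 x y z * z3)"
    using expand[OF K] K' by (simp_all add: pair c_eq_\<theta> hom) (simp_all add: algebra_simps)
  have "z1 \<noteq> 0 \<or> z2 \<noteq> 0 \<or> z3 \<noteq> 0"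
    using K'(3) by (auto elim!: frame_coordsE)
  then show ?thesis using e cancel by blast
qed

end

section \<open>Reduction of an arbitrary bracket function to a normalized one\<close>

context bracket_function
begin

text \<open>Here \<open>c\<close> is the bracket of a point with two corners: those corners carry
  the scales \<open>t2 / k\<close> and \<open>t3 / k\<close>, and the point carries
  \<open>t1 / c\<close>. Everything cancels in pairs.\<close>

lemma scaling_identity:
  assumes "k \<in> Units R" "c \<in> Units R" "t1 \<in> Units R" "t2 \<in> Units R" "t3 \<in> Units R"
  shows "k \<otimes> k \<otimes> inv (t1 \<otimes> t2 \<otimes> t3) \<otimes> (t1 \<otimes> inv c) \<otimes> (t2 \<otimes> inv k) \<otimes> (t3 \<otimes> inv k) \<otimes> c = \<one>"
proof -
  have "k \<otimes> k \<otimes> inv (t1 \<otimes> t2 \<otimes> t3) \<otimes> (t1 \<otimes> inv c) \<otimes> (t2 \<otimes> inv k) \<otimes> (t3 \<otimes> inv k) \<otimes> c =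
    (k \<otimes> inv k) \<otimes> (k \<otimes> inv k) \<otimes> (c \<otimes> inv c) \<otimes> (t1 \<otimes> t2 \<otimes> t3 \<otimes> inv (t1 \<otimes> t2 \<otimes> t3))"
    using assms by (simp add: Units_closed m_ac del: Units_r_inv)
  also have "\<dots> = \<one>"
    using assms by (simp add: Units_closed)
  finally show ?thesis .
qed

theorem coordinatization:
  obtains h c t where "h \<in> ring_hom ring_of_type_algebra R" "c \<in> Units R"
    "\<And>x. x \<in> frame_coords \<Longrightarrow> t x \<in> Units R"
    "\<And>x y z. \<lbrakk>x \<in> frame_coords; y \<in> frame_coords; z \<in> frame_coords\<rbrakk>
      \<Longrightarrow> b x y z = c \<otimes> t x \<otimes> t y \<otimes> t z \<otimes> h (det3 x y z)"
proof -
  define k t1 t2 t3 where "k = b E1 E2 E3" and "t1 = b EE E2 E3" and "t2 = b E1 EE E3"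
    and "t3 = b E1 E2 EE"
  have U [simp]: "k \<in> Units R" "t1 \<in> Units R" "t2 \<in> Units R" "t3 \<in> Units R"
    by (auto simp: k_def t1_def t2_def t3_def intro!: unit)
  note [simp] = U[THEN Units_closed]
  \<comment> \<open>The four frame equations, with the scale of \<open>EE\<close> set to one, force
    the scales \<open>t1 / k\<close>, \<open>t2 / k\<close>, \<open>t3 / k\<close> of the corners
    and this value of the global factor.\<close>
  define c where "c = k \<otimes> k \<otimes> inv (t1 \<otimes> t2 \<otimes> t3)"
  \<comment> \<open>The case split follows the first nonzero coordinate, in accordance with the
    \<open>leading\<close> equations. At a corner the relevant bracket is \<open>k\<close>, so the
    forced scales come out.\<close>
  define s where "s = (\<lambda>x. case x of (x1, x2, x3) \<Rightarrow>
     if x1 \<noteq> 0 then t1 \<otimes> inv b x E2 E3 else if x2 \<noteq> 0 then t2 \<otimes> inv b E1 x E3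
     else t3 \<otimes> inv b E1 E2 x)"
  have c_unit: "c \<in> Units R" by (simp add: c_def)
  have s_unit: "s x \<in> Units R" if "x \<in> frame_coords" for x
    using that by (auto elim!: frame_coordsE simp: s_def unit)
  define b' where "b' = (\<lambda>x y z. c \<otimes> s x \<otimes> s y \<otimes> s z \<otimes> b x y z)"
  interpret s: bracket_function R b'
    unfolding b'_def by (rule scaled[OF c_unit s_unit])
  have sE: "s E1 = t1 \<otimes> inv k" "s E2 = t2 \<otimes> inv k" "s E3 = t3 \<otimes> inv k" "s EE = \<one>"
    by (auto simp: s_def k_def t1_def[symmetric])
  \<comment> \<open>The scale one of \<open>EE\<close> is rewritten as a quotient so that the second
    and third identities in \<open>id\<close> match.\<close>
  have sEE: "s EE = t2 \<otimes> inv t2" "s EE = t3 \<otimes> inv t3"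
    by (simp_all add: sE)
  have id: "c \<otimes> (t1 \<otimes> inv d) \<otimes> (t2 \<otimes> inv k) \<otimes> (t3 \<otimes> inv k) \<otimes> d = \<one>"
    "c \<otimes> (t1 \<otimes> inv k) \<otimes> (t2 \<otimes> inv d) \<otimes> (t3 \<otimes> inv k) \<otimes> d = \<one>"
    "c \<otimes> (t1 \<otimes> inv k) \<otimes> (t2 \<otimes> inv k) \<otimes> (t3 \<otimes> inv d) \<otimes> d = \<one>"
    if "d \<in> Units R" for d
    using scaling_identity[of k d t1 t2 t3] that Units_closed[OF c_unit]
    by (simp_all add: c_def Units_closed m_ac)
  interpret n: normalized_bracket_function R b'
  proof unfold_locales
    show "b' E1 E2 E3 = \<one>"
      unfolding b'_def sE k_def[symmetric] by (rule id) simp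
    show "b' EE E2 E3 = \<one>"
      using id(1)[of t1] unfolding b'_def sE t1_def[symmetric] by simp
    show "b' E1 EE E3 = \<one>"
      unfolding b'_def sE(1-3) sEE(1) t2_def[symmetric] by (rule id) simp
    show "b' E1 E2 EE = \<one>"
      unfolding b'_def sE(1-3) sEE(2) t3_def[symmetric] by (rule id) simp
    fix a
    have "s (1, a, 0) = t1 \<otimes> inv b (1, a, 0) E2 E3" by (simp add: s_def)
    then show "b' (1, a, 0) E2 E3 = \<one>"
      unfolding b'_def sE by (simp only:) (rule id, rule unit, auto)
    have "s (1, 0, a) = t1 \<otimes> inv b (1, 0, a) E2 E3" by (simp add: s_def)
    then show "b' (1, 0, a) E2 E3 = \<one>"
      unfolding b'_def sE by (simp only:) (rule id, rule unit, auto)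
    have "s (0, 1, a) = t2 \<otimes> inv b E1 (0, 1, a) E3" by (simp add: s_def)
    then show "b' E1 (0, 1, a) E3 = \<one>"
      unfolding b'_def sE by (simp only:) (rule id, rule unit, auto)
  qed
  show thesis
  proof (rule that[of n.\<theta> "inv c" "\<lambda>x. inv s x"])
    show "n.\<theta> \<in> ring_hom ring_of_type_algebra R" by (rule n.\<theta>_ring_hom)
    show "inv c \<in> Units R" using c_unit by simp
    show "inv s x \<in> Units R" if "x \<in> frame_coords" for x using s_unit[OF that] by simp
    fix x y z :: "'f triple"
    assume K: "x \<in> frame_coords" "y \<in> frame_coords" "z \<in> frame_coords"
    note u = c_unit K[THEN s_unit]
    let ?p = "inv c \<otimes> inv s x \<otimes> inv s y \<otimes> inv s z"
    have "?p \<otimes> n.\<theta> (det3 x y z) = ?p \<otimes> (c \<otimes> s x \<otimes> s y \<otimes> s z \<otimes> b x y z)"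
      by (simp only: n.bracket_eq_det3[OF K, symmetric]) (simp only: b'_def)
    also have "\<dots> = (inv c \<otimes> c) \<otimes> (inv s x \<otimes> s x) \<otimes> (inv s y \<otimes> s y) \<otimes> (inv s z \<otimes> s z) \<otimes> b x y z"
      using u closed[OF K] by (simp add: Units_closed m_ac del: Units_l_inv Units_r_inv)
    also have "\<dots> = b x y z"
      using u closed[OF K] by simp
    finally show "b x y z = ?p \<otimes> n.\<theta> (det3 x y z)" ..
  qed
qed

end

section \<open>Integer polynomials and the bracket ring\<close>

text \<open>Evaluation has a single purpose: sending bracket symbols to determinants over the field
  shows that one is not in the bracket ideal.\<close>

definition eval_monomial :: "('v \<Rightarrow> 'a::comm_ring_1) \<Rightarrow> ('v \<Rightarrow>\<^sub>0 nat) \<Rightarrow> 'a" where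
  "eval_monomial f m = (\<Prod>v\<in>Poly_Mapping.keys m. f v ^ Poly_Mapping.lookup m v)"

definition eval_mpoly :: "('v \<Rightarrow> 'a::comm_ring_1) \<Rightarrow> 'v int_mpoly \<Rightarrow> 'a" where
  "eval_mpoly f p =
     (\<Sum>m\<in>Poly_Mapping.keys p. of_int (Poly_Mapping.lookup p m) * eval_monomial f m)"

text \<open>The index set in the definition depends on the monomial; to compare several monomials,
  the product is taken over a common finite set.\<close>

lemma eval_monomial_superset:
  assumes "finite S" "Poly_Mapping.keys m \<subseteq> S"
  shows "eval_monomial f m = (\<Prod>v\<in>S. f v ^ Poly_Mapping.lookup m v)"
  unfolding eval_monomial_def
  by (rule prod.mono_neutral_left) (use assms in \<open>auto simp: in_keys_iff\<close>)

lemma eval_monomial_add: "eval_monomial f (m + n) = eval_monomial f m * eval_monomial f n"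
proof -
  let ?S = "Poly_Mapping.keys m \<union> Poly_Mapping.keys n"
  have "eval_monomial f (m + n) = (\<Prod>v\<in>?S. f v ^ Poly_Mapping.lookup (m + n) v)"
    by (rule eval_monomial_superset) (use keys_add[of m n] in auto)
  then show ?thesis
    by (simp add: eval_monomial_superset[of ?S m] eval_monomial_superset[of ?S n]
        lookup_add power_add prod.distrib)
qed

lemma eval_mpoly_superset:
  assumes "finite S" "Poly_Mapping.keys p \<subseteq> S"
  shows "eval_mpoly f p = (\<Sum>m\<in>S. of_int (Poly_Mapping.lookup p m) * eval_monomial f m)"
  unfolding eval_mpoly_def
  by (rule sum.mono_neutral_left) (use assms in \<open>auto simp: in_keys_iff\<close>)

lemma eval_mpoly_add: "eval_mpoly f (p + q) = eval_mpoly f p + eval_mpoly f q"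
proof -
  let ?S = "Poly_Mapping.keys p \<union> Poly_Mapping.keys q"
  have "eval_mpoly f (p + q) =
      (\<Sum>m\<in>?S. of_int (Poly_Mapping.lookup (p + q) m) * eval_monomial f m)"
    by (rule eval_mpoly_superset) (use keys_add[of p q] in auto)
  then show ?thesis
    by (simp add: eval_mpoly_superset[of ?S p] eval_mpoly_superset[of ?S q]
        lookup_add distrib_right sum.distrib)
qed

lemma eval_mpoly_zero [simp]: "eval_mpoly f 0 = 0"
  by (simp add: eval_mpoly_def)

lemma eval_mpoly_uminus: "eval_mpoly f (- p) = - eval_mpoly f p"
  using eval_mpoly_add[of f p "- p"] by (simp add: eq_neg_iff_add_eq_0 add.commute)

lemma eval_mpoly_diff: "eval_mpoly f (p - q) = eval_mpoly f p - eval_mpoly f q"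
  using eval_mpoly_add[of f p "- q"] by (simp add: eval_mpoly_uminus)

lemma eval_mpoly_sum: "eval_mpoly f (\<Sum>i\<in>I. g i) = (\<Sum>i\<in>I. eval_mpoly f (g i))"
  by (induction I rule: infinite_finite_induct) (simp_all add: eval_mpoly_add)

lemma eval_mpoly_single: "eval_mpoly f (Poly_Mapping.single m c) = of_int c * eval_monomial f m"
  by (simp add: eval_mpoly_def)

lemma sum_single: "(\<Sum>m\<in>Poly_Mapping.keys p. Poly_Mapping.single m (Poly_Mapping.lookup p m)) = p"
proof (rule poly_mapping_eqI)
  fix k
  have "Poly_Mapping.lookup (\<Sum>m\<in>Poly_Mapping.keys p. Poly_Mapping.single m (Poly_Mapping.lookup p m)) k
    = (\<Sum>m\<in>Poly_Mapping.keys p. if m = k then Poly_Mapping.lookup p m else 0)"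
    unfolding lookup_sum by (intro sum.cong) (auto simp: lookup_single when_def)
  then show "Poly_Mapping.lookup (\<Sum>m\<in>Poly_Mapping.keys p. Poly_Mapping.single m (Poly_Mapping.lookup p m)) k
    = Poly_Mapping.lookup p k"
    by (simp add: in_keys_iff)
qed

text \<open>Writing both factors as sums of single terms reduces the claim to
  \<open>eval_monomial_add\<close>.\<close>

lemma eval_mpoly_mult: "eval_mpoly f (p * q) = eval_mpoly f p * eval_mpoly f q"
proof -
  let ?s = "\<lambda>p m. Poly_Mapping.single m (Poly_Mapping.lookup p m)"
  have "eval_mpoly f (p * q) =
      eval_mpoly f ((\<Sum>m\<in>Poly_Mapping.keys p. ?s p m) * (\<Sum>n\<in>Poly_Mapping.keys q. ?s q n))"
    by (simp only: sum_single)
  also have "\<dots> = (\<Sum>m\<in>Poly_Mapping.keys p. \<Sum>n\<in>Poly_Mapping.keys q.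
      eval_mpoly f (?s p m) * eval_mpoly f (?s q n))"
    unfolding sum_product eval_mpoly_sum mult_single eval_mpoly_single eval_monomial_add of_int_mult
    by (intro sum.cong) (simp_all add: mult_ac)
  also have "\<dots> = eval_mpoly f (\<Sum>m\<in>Poly_Mapping.keys p. ?s p m) *
      eval_mpoly f (\<Sum>n\<in>Poly_Mapping.keys q. ?s q n)"
    unfolding eval_mpoly_sum by (rule sum_product[symmetric])
  finally show ?thesis by (simp only: sum_single)
qed

lemma eval_mpoly_of_int: "eval_mpoly f (of_int c) = of_int c"
  unfolding single_of_int[symmetric] eval_mpoly_single by (simp add: eval_monomial_def)

lemma eval_mpoly_one: "eval_mpoly f 1 = 1"
  using eval_mpoly_of_int[of f 1] by simp

lemma eval_mpoly_mvar [simp]: "eval_mpoly f (mvar v) = f v"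
  by (simp add: mvar_def eval_mpoly_single eval_monomial_def)

lemma int_mpoly_ring_simps [simp]:
  "x \<otimes>\<^bsub>int_mpoly_ring V\<^esub> y = x * y" "x \<oplus>\<^bsub>int_mpoly_ring V\<^esub> y = x + y"
  "\<one>\<^bsub>int_mpoly_ring V\<^esub> = 1" "\<zero>\<^bsub>int_mpoly_ring V\<^esub> = 0"
  by (simp_all add: int_mpoly_ring_def)

lemma carrier_int_mpoly_ring:
  "carrier (int_mpoly_ring V) = {p. \<forall>m\<in>Poly_Mapping.keys p. Poly_Mapping.keys m \<subseteq> V}"
  by (simp add: int_mpoly_ring_def)

lemma int_mpoly_ring_closed:
  "0 \<in> carrier (int_mpoly_ring V)" "1 \<in> carrier (int_mpoly_ring V)"
  "of_int c \<in> carrier (int_mpoly_ring V)"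
  "v \<in> V \<Longrightarrow> mvar v \<in> carrier (int_mpoly_ring V)"
  "p \<in> carrier (int_mpoly_ring V) \<Longrightarrow> - p \<in> carrier (int_mpoly_ring V)"
  "p \<in> carrier (int_mpoly_ring V) \<Longrightarrow> q \<in> carrier (int_mpoly_ring V) \<Longrightarrow> p + q \<in> carrier (int_mpoly_ring V)"
  "p \<in> carrier (int_mpoly_ring V) \<Longrightarrow> q \<in> carrier (int_mpoly_ring V) \<Longrightarrow> p - q \<in> carrier (int_mpoly_ring V)"
  "p \<in> carrier (int_mpoly_ring V) \<Longrightarrow> q \<in> carrier (int_mpoly_ring V) \<Longrightarrow> p * q \<in> carrier (int_mpoly_ring V)"
proof -
  show "0 \<in> carrier (int_mpoly_ring V)" "1 \<in> carrier (int_mpoly_ring V)"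
    by (auto simp: carrier_int_mpoly_ring)
  show "of_int c \<in> carrier (int_mpoly_ring V)"
    unfolding single_of_int[symmetric] by (auto simp: carrier_int_mpoly_ring)
  show "v \<in> V \<Longrightarrow> mvar v \<in> carrier (int_mpoly_ring V)"
    by (auto simp: carrier_int_mpoly_ring mvar_def)
  have minus: "- p \<in> carrier (int_mpoly_ring V)" if "p \<in> carrier (int_mpoly_ring V)" for p
    using that by (auto simp: carrier_int_mpoly_ring keys_minus)
  have add: "p + q \<in> carrier (int_mpoly_ring V)"
    if "p \<in> carrier (int_mpoly_ring V)" "q \<in> carrier (int_mpoly_ring V)" for p q
    using that keys_add[of p q] unfolding carrier_int_mpoly_ring by blast
  show "p \<in> carrier (int_mpoly_ring V) \<Longrightarrow> - p \<in> carrier (int_mpoly_ring V)"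
    by (rule minus)
  show "p \<in> carrier (int_mpoly_ring V) \<Longrightarrow> q \<in> carrier (int_mpoly_ring V) \<Longrightarrow> p + q \<in> carrier (int_mpoly_ring V)"
    by (rule add)
  show "p \<in> carrier (int_mpoly_ring V) \<Longrightarrow> q \<in> carrier (int_mpoly_ring V) \<Longrightarrow> p - q \<in> carrier (int_mpoly_ring V)"
    using add[of p "- q"] minus[of q] by simp
  show "p * q \<in> carrier (int_mpoly_ring V)"
    if p: "p \<in> carrier (int_mpoly_ring V)" and q: "q \<in> carrier (int_mpoly_ring V)"
  proof -
    have "Poly_Mapping.keys m \<subseteq> V" if m: "m \<in> Poly_Mapping.keys (p * q)" for m
    proof -
      obtain m1 m2 where "m1 \<in> Poly_Mapping.keys p" "m2 \<in> Poly_Mapping.keys q" "m = m1 + m2"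
        using keys_mult[of p q] m by blast
      then show ?thesis using p q keys_add[of m1 m2] unfolding carrier_int_mpoly_ring by blast
    qed
    then show ?thesis by (auto simp: carrier_int_mpoly_ring)
  qed
qed

lemma cring_int_mpoly_ring: "cring (int_mpoly_ring V)"
proof (rule cringI)
  show "abelian_group (int_mpoly_ring V)"
    by (rule abelian_groupI)
      (auto simp: int_mpoly_ring_closed add_ac intro: bexI[OF _ int_mpoly_ring_closed(5)])
  show "comm_monoid (int_mpoly_ring V)"
    by (rule comm_monoidI) (auto simp: int_mpoly_ring_closed mult_ac)
qed (simp add: distrib_right)

lemma eval_mpoly_ring_hom: "eval_mpoly f \<in> ring_hom (int_mpoly_ring V) ring_of_type_algebra"
  by (rule ring_hom_memI) (auto simp: eval_mpoly_mult eval_mpoly_add eval_mpoly_one)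

section \<open>The quotient by the bracket ideal and the relations among bracket classes\<close>

lemma cring_bracket_poly_ring: "cring (bracket_poly_ring M)"
  unfolding bracket_poly_ring_def by (rule cring_int_mpoly_ring)

lemma br_closed: "Z \<in> tuples M \<Longrightarrow> br Z \<in> carrier (bracket_poly_ring M)"
  and inv_br_closed: "Z \<in> basis_tuples M \<Longrightarrow> inv_br Z \<in> carrier (bracket_poly_ring M)"
  unfolding bracket_poly_ring_def by (auto intro: int_mpoly_ring_closed)

lemma permute_list_tuples:
  assumes "Z \<in> tuples M" "\<sigma> permutes {..<matroid_rank M}"
  shows "permute_list \<sigma> Z \<in> tuples M"
  using assms by (auto simp: tuples_def)

lemma tuples_Cons2:
  assumes "{x1, x2} \<union> set W \<subseteq> ground M" "length W + 2 = matroid_rank M"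
  shows "x1 # x2 # W \<in> tuples M"
  using assms by (auto simp: tuples_def)

lemma bracket_relations_closed: "bracket_relations M \<subseteq> carrier (bracket_poly_ring M)"
proof -
  note closed = int_mpoly_ring_closed[where V = "Bracket ` tuples M \<union> Inv_Bracket ` basis_tuples M",
      folded bracket_poly_ring_def]
  have "basis_tuples M \<subseteq> tuples M" by (auto simp: basis_tuples_def)
  then show ?thesis
    unfolding bracket_relations_def
    by (auto intro!: closed(2,3,6-8) br_closed inv_br_closed permute_list_tuples tuples_Cons2)
qed

lemma ideal_bracket_ideal: "ideal (bracket_ideal M) (bracket_poly_ring M)"
  unfolding bracket_ideal_def
  by (rule ring.genideal_ideal[OF cring.axioms(1)[OF cring_bracket_poly_ring] bracket_relations_closed])

lemma bracket_relations_in_ideal: "bracket_relations M \<subseteq> bracket_ideal M"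
  unfolding bracket_ideal_def
  by (rule ring.genideal_self[OF cring.axioms(1)[OF cring_bracket_poly_ring] bracket_relations_closed])

lemma cring_bracket_ring: "cring (bracket_ring M)"
  unfolding bracket_ring_def
  by (rule ideal.quotient_is_cring[OF ideal_bracket_ideal cring_bracket_poly_ring])

definition bracket_proj :: "'e matroid \<Rightarrow> 'e bracket int_mpoly \<Rightarrow> 'e bracket int_mpoly set" where
  "bracket_proj M p = bracket_ideal M +>\<^bsub>bracket_poly_ring M\<^esub> p"

lemma bracket_class_eq: "bracket_class M Z = bracket_proj M (br Z)"
  by (simp add: bracket_class_def bracket_proj_def)

lemma bracket_proj_hom: "bracket_proj M \<in> ring_hom (bracket_poly_ring M) (bracket_ring M)"
proof -
  have "bracket_proj M = (+>\<^bsub>bracket_poly_ring M\<^esub>) (bracket_ideal M)"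
    by (auto simp: bracket_proj_def)
  then show ?thesis
    unfolding bracket_ring_def using ideal.rcos_ring_hom[OF ideal_bracket_ideal] by simp
qed

lemma bracket_proj_eq_zero:
  assumes "p \<in> bracket_ideal M"
  shows "bracket_proj M p = \<zero>\<^bsub>bracket_ring M\<^esub>"
proof -
  interpret I: ideal "bracket_ideal M" "bracket_poly_ring M" by (rule ideal_bracket_ideal)
  show ?thesis
    unfolding bracket_proj_def bracket_ring_def FactRing_def
    by (simp add: I.a_rcos_zero[OF ideal_bracket_ideal assms])
qed

lemma bracket_proj_eq_zeroD:
  assumes "bracket_proj M p = \<zero>\<^bsub>bracket_ring M\<^esub>" "p \<in> carrier (bracket_poly_ring M)"
  shows "p \<in> bracket_ideal M"
proof -
  interpret I: ideal "bracket_ideal M" "bracket_poly_ring M" by (rule ideal_bracket_ideal)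
  show ?thesis
    using assms I.rcos_const_imp_mem[OF assms(2)]
    by (simp add: bracket_proj_def bracket_ring_def FactRing_def)
qed

context
  fixes M :: "'e matroid"
begin

interpretation P: cring "bracket_poly_ring M" by (rule cring_bracket_poly_ring)
interpretation B: cring "bracket_ring M" by (rule cring_bracket_ring)
interpretation H: ring_hom_cring "bracket_poly_ring M" "bracket_ring M" "bracket_proj M"
  by unfold_locales (rule bracket_proj_hom)

lemma poly_ops:
  "x \<otimes>\<^bsub>bracket_poly_ring M\<^esub> y = x * y" "x \<oplus>\<^bsub>bracket_poly_ring M\<^esub> y = x + y"
  "\<one>\<^bsub>bracket_poly_ring M\<^esub> = 1" "\<zero>\<^bsub>bracket_poly_ring M\<^esub> = 0"
  by (simp_all add: bracket_poly_ring_def)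

lemma poly_closed:
  "p \<in> carrier (bracket_poly_ring M) \<Longrightarrow> - p \<in> carrier (bracket_poly_ring M)"
  "p \<in> carrier (bracket_poly_ring M) \<Longrightarrow> q \<in> carrier (bracket_poly_ring M) \<Longrightarrow> p * q \<in> carrier (bracket_poly_ring M)"
  by (auto simp: bracket_poly_ring_def int_mpoly_ring_closed)

lemma poly_minus:
  assumes p: "p \<in> carrier (bracket_poly_ring M)"
  shows "\<ominus>\<^bsub>bracket_poly_ring M\<^esub> p = - p"
proof -
  have "- p \<oplus>\<^bsub>bracket_poly_ring M\<^esub> p = \<zero>\<^bsub>bracket_poly_ring M\<^esub>"
    by (simp add: poly_ops)
  then show ?thesis
    using P.minus_equality[OF _ p poly_closed(1)[OF p]] by simp
qed

text \<open>The bridge from the relations, written with the subtraction of the polynomial type, to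
  equations in the quotient, whose operations are those of a ring record.\<close>

lemma bracket_proj_diff_eq_zero:
  assumes "p \<in> carrier (bracket_poly_ring M)" "q \<in> carrier (bracket_poly_ring M)"
    and "p - q \<in> bracket_ideal M"
  shows "bracket_proj M p = bracket_proj M q"
proof -
  have "p \<ominus>\<^bsub>bracket_poly_ring M\<^esub> q = p - q"
    using assms by (simp add: P.minus_eq poly_minus poly_ops)
  then have "bracket_proj M p \<ominus>\<^bsub>bracket_ring M\<^esub> bracket_proj M q = \<zero>\<^bsub>bracket_ring M\<^esub>"
    using assms bracket_proj_eq_zero[OF assms(3)] H.hom_sub by metis
  then show ?thesis
    using assms(1,2) by (simp add: B.r_right_minus_eq)
qed

lemma bracket_class_closed:
  assumes "Z \<in> tuples M"
  shows "bracket_class M Z \<in> carrier (bracket_ring M)"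
  unfolding bracket_class_eq using br_closed[OF assms] by simp

lemma bracket_class_zero:
  assumes "Z \<in> tuples M" "set Z \<notin> bases M"
  shows "bracket_class M Z = \<zero>\<^bsub>bracket_ring M\<^esub>"
  unfolding bracket_class_eq
  by (rule bracket_proj_eq_zero, rule subsetD[OF bracket_relations_in_ideal])
    (use assms in \<open>auto simp: bracket_relations_def\<close>)

text \<open>Transpositions are all that will be applied, and for sign \<open>- 1\<close> relation
  (2) becomes a plain negation in the quotient.\<close>

lemma bracket_class_odd:
  assumes Z: "Z \<in> tuples M" and \<sigma>: "\<sigma> permutes {..<matroid_rank M}" "sign \<sigma> = - 1"
  shows "bracket_class M (permute_list \<sigma> Z) = \<ominus>\<^bsub>bracket_ring M\<^esub> bracket_class M Z"
proof -
  have "br Z - of_int (sign \<sigma>) * br (permute_list \<sigma> Z) \<in> bracket_relations M"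
    unfolding bracket_relations_def using Z \<sigma>(1) by blast
  then have "br Z - (- br (permute_list \<sigma> Z)) \<in> bracket_ideal M"
    using subsetD[OF bracket_relations_in_ideal] \<sigma>(2) by simp
  then have "bracket_proj M (br Z) = bracket_proj M (- br (permute_list \<sigma> Z))"
    by (intro bracket_proj_diff_eq_zero br_closed poly_closed permute_list_tuples Z \<sigma>)
  also have "\<dots> = \<ominus>\<^bsub>bracket_ring M\<^esub> bracket_proj M (br (permute_list \<sigma> Z))"
    using br_closed[OF permute_list_tuples[OF Z \<sigma>(1)]] H.hom_a_inv by (simp flip: poly_minus)
  finally show ?thesis
    using br_closed[OF permute_list_tuples[OF Z \<sigma>(1)]] by (simp add: bracket_class_eq)
qed

lemma bracket_class_plucker:
  assumes "{x1, x2, y1, y2} \<union> set W \<subseteq> ground M" "length W + 2 = matroid_rank M"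
  shows "bracket_class M (x1 # x2 # W) \<otimes>\<^bsub>bracket_ring M\<^esub> bracket_class M (y1 # y2 # W) =
     bracket_class M (y1 # x2 # W) \<otimes>\<^bsub>bracket_ring M\<^esub> bracket_class M (x1 # y2 # W)
     \<oplus>\<^bsub>bracket_ring M\<^esub> bracket_class M (y2 # x2 # W) \<otimes>\<^bsub>bracket_ring M\<^esub> bracket_class M (y1 # x1 # W)"
proof -
  have c: "br (u # v # W) \<in> carrier (bracket_poly_ring M)"
    if "u \<in> {x1, x2, y1, y2}" "v \<in> {x1, x2, y1, y2}" for u v
    by (rule br_closed, rule tuples_Cons2) (use assms that in auto)
  have "br (x1 # x2 # W) * br (y1 # y2 # W) - br (y1 # x2 # W) * br (x1 # y2 # W)
        - br (y2 # x2 # W) * br (y1 # x1 # W) \<in> bracket_relations M"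
    unfolding bracket_relations_def by (rule UnI1, rule UnI2) (use assms in blast)
  then have "br (x1 # x2 # W) * br (y1 # y2 # W) - (br (y1 # x2 # W) * br (x1 # y2 # W)
        + br (y2 # x2 # W) * br (y1 # x1 # W)) \<in> bracket_ideal M"
    using subsetD[OF bracket_relations_in_ideal] by (simp add: diff_diff_add)
  then have "bracket_proj M (br (x1 # x2 # W) * br (y1 # y2 # W)) =
     bracket_proj M (br (y1 # x2 # W) * br (x1 # y2 # W) + br (y2 # x2 # W) * br (y1 # x1 # W))"
    by (intro bracket_proj_diff_eq_zero)
      (auto simp flip: poly_ops intro!: P.m_closed P.a_closed c)
  then show ?thesis
    by (simp add: bracket_class_eq c flip: poly_ops)
qed

lemma bracket_class_unit:
  assumes Z: "Z \<in> basis_tuples M"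
  shows "bracket_class M Z \<in> Units (bracket_ring M)"
proof -
  have Z': "Z \<in> tuples M" using Z by (simp add: basis_tuples_def)
  have "br Z * inv_br Z - 1 \<in> bracket_ideal M"
    using Z bracket_relations_in_ideal unfolding bracket_relations_def by blast
  then have "bracket_proj M (br Z * inv_br Z) = bracket_proj M 1"
    using P.one_closed by (intro bracket_proj_diff_eq_zero poly_closed br_closed inv_br_closed Z Z')
      (simp_all add: poly_ops)
  then have "bracket_class M Z \<otimes>\<^bsub>bracket_ring M\<^esub> bracket_proj M (inv_br Z) = \<one>\<^bsub>bracket_ring M\<^esub>"
    using H.hom_mult[OF br_closed[OF Z'] inv_br_closed[OF Z]] H.hom_one
    by (simp add: bracket_class_eq poly_ops)
  then show ?thesis
    using bracket_class_closed[OF Z'] H.hom_closed[OF inv_br_closed[OF Z]] B.m_comm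
    by (auto simp: Units_def intro!: bexI[of _ "bracket_proj M (inv_br Z)"])
qed

text \<open>The kernel of the evaluation is an ideal that contains the relations, hence the bracket
  ideal. If one were in the bracket ideal, it would evaluate to zero.\<close>

lemma bracket_ring_nontrivial:
  fixes f :: "'e bracket \<Rightarrow> 'f::field"
  assumes "\<And>p. p \<in> bracket_relations M \<Longrightarrow> eval_mpoly f p = 0"
  shows "\<one>\<^bsub>bracket_ring M\<^esub> \<noteq> \<zero>\<^bsub>bracket_ring M\<^esub>"
proof
  assume "\<one>\<^bsub>bracket_ring M\<^esub> = \<zero>\<^bsub>bracket_ring M\<^esub>"
  then have "bracket_proj M 1 = \<zero>\<^bsub>bracket_ring M\<^esub>"
    using H.hom_one by (simp add: poly_ops)
  then have 1: "1 \<in> bracket_ideal M"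
    using bracket_proj_eq_zeroD P.one_closed by (simp add: poly_ops)
  interpret E: ring_hom_ring "bracket_poly_ring M" ring_of_type_algebra "eval_mpoly f"
    unfolding bracket_poly_ring_def
    by (intro ring_hom_ringI2 ring_from_type_algebra eval_mpoly_ring_hom cring.axioms(1)
        cring_int_mpoly_ring)
  have "ideal (a_kernel (bracket_poly_ring M) ring_of_type_algebra (eval_mpoly f)) (bracket_poly_ring M)"
    by (rule E.kernel_is_ideal)
  moreover have "bracket_relations M \<subseteq> a_kernel (bracket_poly_ring M) ring_of_type_algebra (eval_mpoly f)"
    unfolding a_kernel_def' by (intro subsetI CollectI conjI subsetD[OF bracket_relations_closed]) (simp_all add: assms)
  ultimately have "bracket_ideal M \<subseteq> a_kernel (bracket_poly_ring M) ring_of_type_algebra (eval_mpoly f)"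
    unfolding bracket_ideal_def by (rule P.genideal_minimal)
  from subsetD[OF this 1] have "eval_mpoly f 1 = \<zero>\<^bsub>ring_of_type_algebra\<^esub>"
    unfolding a_kernel_def' by blast
  then show False by (simp only: eval_mpoly_one ring_of_type_algebra_simps one_neq_zero)
qed

end

section \<open>Minors and cross ratios of matrices over a field image\<close>

text \<open>The product of \<open>diag r\<close>, the image of \<open>a\<close> under
  \<open>h\<close> and \<open>diag s\<close>, restricted to the labels in use. The diagonal factors
  drop out of cross ratios, so only \<open>a\<close> matters for them.\<close>

definition scaled_matrix ::
  "'a ring \<Rightarrow> ('f \<Rightarrow> 'a) \<Rightarrow> ('e \<Rightarrow> 'a) \<Rightarrow> ('e \<Rightarrow> 'a) \<Rightarrow> ('e \<Rightarrow> 'e \<Rightarrow> 'f) \<Rightarrow> ('e, 'a) lmatrix \<Rightarrow> bool" where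
  "scaled_matrix R h r s a = (\<lambda>(S, T, D). (\<forall>u\<in>S. r u \<in> Units R) \<and> (\<forall>v\<in>T. s v \<in> Units R) \<and>
     (\<forall>u\<in>S. \<forall>v\<in>T. D u v = r u \<otimes>\<^bsub>R\<^esub> h (a u v) \<otimes>\<^bsub>R\<^esub> s v))"

definition field_pivot :: "'e \<Rightarrow> 'e \<Rightarrow> ('e \<Rightarrow> 'e \<Rightarrow> 'f::field) \<Rightarrow> 'e \<Rightarrow> 'e \<Rightarrow> 'f" where
  "field_pivot x y a u v =
     (if u = y then if v = x then 1 / a x y else a x v / a x y
      else if v = x then - (a u y / a x y) else a u v - a u y * a x v / a x y)"

locale field_hom = cring R for R :: "'a ring" (structure) +
  fixes h :: "'f::field \<Rightarrow> 'a"
  assumes h: "h \<in> ring_hom ring_of_type_algebra R"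
    and nontrivial: "\<one> \<noteq> \<zero>"
begin

lemma h_closed [simp]: "h a \<in> carrier R"
  using ring_hom_closed[OF h] by simp

lemma h_mult: "h (a * d) = h a \<otimes> h d"
  and h_add: "h (a + d) = h a \<oplus> h d"
  and h_one [simp]: "h 1 = \<one>"
  using ring_hom_mult[OF h, of a d] ring_hom_add[OF h, of a d] ring_hom_one[OF h] by simp_all

lemma h_zero [simp]: "h 0 = \<zero>"
  using h_add[of 0 0] by simp

lemma h_uminus: "h (- a) = \<ominus> h a"
  using h_add[of "- a" a] by (simp add: minus_equality)

lemma h_diff: "h (a - d) = h a \<ominus> h d"
  using h_add[of a "- d"] by (simp add: h_uminus minus_eq)

lemma h_Units [simp]: "a \<noteq> 0 \<Longrightarrow> h a \<in> Units R"
  by (rule ring_hom_field_Units[OF h])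

lemma zero_not_unit: "\<zero> \<notin> Units R"
  using nontrivial by (auto simp: Units_def)

lemma h_eq_zero_iff [simp]: "h a = \<zero> \<longleftrightarrow> a = 0"
  by (metis h_Units h_zero zero_not_unit)

lemma h_inj: "inj h"
proof (rule injI)
  fix a d assume "h a = h d"
  then have "h (a - d) = \<zero>" by (simp add: h_diff r_right_minus_eq)
  then show "a = d" by simp
qed

lemma h_inv: "a \<noteq> 0 \<Longrightarrow> inv h a = h (1 / a)"
  by (rule comm_inv_char) (simp_all flip: h_mult)

lemma inv_entry:
  assumes "u \<in> Units R" "v \<in> Units R" "a \<noteq> 0"
  shows "inv (u \<otimes> h a \<otimes> v) = inv v \<otimes> h (1 / a) \<otimes> inv u"
proof (rule comm_inv_char)
  have "u \<otimes> h a \<otimes> v \<otimes> (inv v \<otimes> h (1 / a) \<otimes> inv u) =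
      (u \<otimes> inv u) \<otimes> (v \<otimes> inv v) \<otimes> (h a \<otimes> h (1 / a))"
    using assms by (simp add: Units_closed m_ac del: Units_r_inv Units_l_inv)
  also have "\<dots> = \<one>"
    using assms by (simp flip: h_mult)
  finally show "u \<otimes> h a \<otimes> v \<otimes> (inv v \<otimes> h (1 / a) \<otimes> inv u) = \<one>" .
qed (use assms in \<open>simp_all add: Units_closed\<close>)

lemma inv_cancel:
  assumes "v \<in> Units R" "c \<in> carrier R"
  shows "inv v \<otimes> (v \<otimes> c) = c" "v \<otimes> (inv v \<otimes> c) = c"
  using assms by (simp_all add: Units_closed flip: m_assoc)

text \<open>The inverted pivot entry is \<open>inv (s y)\<close> times a field value times
  \<open>inv (r x)\<close>. Hence the new row \<open>y\<close> inherits the inverse scale of the old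
  column \<open>y\<close>, and the new column \<open>x\<close> that of the old row
  \<open>x\<close>.\<close>

lemma scaled_matrix_pivot:
  assumes A: "scaled_matrix R h r s a (S, T, D)" and x: "x \<in> S" and y: "y \<in> T"
    and nz: "D x y \<noteq> \<zero>"
  shows "a x y \<noteq> 0"
    and "scaled_matrix R h (r(y := inv (s y))) (s(x := inv (r x))) (field_pivot x y a)
      (pivot R x y (S, T, D))"
proof -
  have D: "D u v = r u \<otimes> h (a u v) \<otimes> s v" if "u \<in> S" "v \<in> T" for u v
    using A that by (auto simp: scaled_matrix_def)
  have r: "r u \<in> Units R" if "u \<in> S" for u using A that by (auto simp: scaled_matrix_def)
  have s: "s v \<in> Units R" if "v \<in> T" for v using A that by (auto simp: scaled_matrix_def)
  show axy: "a x y \<noteq> 0"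
    using nz D[OF x y] r[OF x] s[OF y] by (auto simp: Units_closed)
  let ?i = "inv (s y) \<otimes> h (1 / a x y) \<otimes> inv (r x)"
  have inv: "inv (D x y) = ?i"
    unfolding D[OF x y] by (rule inv_entry[OF r[OF x] s[OF y] axy])
  note C = r[OF x] s[OF y] Units_closed[OF r[OF x]] Units_closed[OF s[OF y]]
  have row: "?i \<otimes> D x v = inv (s y) \<otimes> h (a x v / a x y) \<otimes> s v" if "v \<in> T" for v
  proof -
    have "?i \<otimes> D x v =
        (r x \<otimes> inv (r x)) \<otimes> (inv (s y) \<otimes> (h (a x v) \<otimes> h (1 / a x y)) \<otimes> s v)"
      using C s[OF that] Units_closed[OF s[OF that]]
      by (simp add: D[OF x that] m_ac del: Units_r_inv Units_l_inv)
    then show ?thesis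
      using C Units_closed[OF s[OF that]] by (simp flip: h_mult)
  qed
  have col: "?i \<otimes> D u y = r u \<otimes> h (a u y / a x y) \<otimes> inv (r x)" if "u \<in> S" for u
  proof -
    have "?i \<otimes> D u y =
        (s y \<otimes> inv (s y)) \<otimes> (r u \<otimes> (h (a u y) \<otimes> h (1 / a x y)) \<otimes> inv (r x))"
      using C r[OF that] Units_closed[OF r[OF that]]
      by (simp add: D[OF that y] m_ac del: Units_r_inv Units_l_inv)
    then show ?thesis
      using C Units_closed[OF r[OF that]] by (simp flip: h_mult)
  qed
  have rest: "D u v \<ominus> ?i \<otimes> D u y \<otimes> D x v =
      r u \<otimes> h (a u v - a u y * a x v / a x y) \<otimes> s v" if u: "u \<in> S" and v: "v \<in> T" for u v
  proof -
    note C' = C r[OF u] Units_closed[OF r[OF u]] s[OF v] Units_closed[OF s[OF v]]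
    have "?i \<otimes> D u y \<otimes> D x v =
        (r x \<otimes> inv (r x)) \<otimes> (r u \<otimes> (h (a u y / a x y) \<otimes> h (a x v)) \<otimes> s v)"
      unfolding col[OF u] D[OF x v] using C' by (simp add: m_ac del: Units_r_inv Units_l_inv)
    also have "\<dots> = r u \<otimes> h (a u y * a x v / a x y) \<otimes> s v"
      using C' by (simp flip: h_mult)
    finally show ?thesis
      using C' unfolding h_diff D[OF u v]
      by (simp add: minus_eq l_distr r_distr l_minus r_minus)
  qed
  show "scaled_matrix R h (r(y := inv (s y))) (s(x := inv (r x))) (field_pivot x y a)
      (pivot R x y (S, T, D))"
    unfolding scaled_matrix_def pivot_def
    using r s x y row[folded inv] col[folded inv] rest[folded inv]
    by (auto simp: inv field_pivot_def h_uminus l_minus r_minus Units_closed)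
qed

text \<open>The scales and the field matrix change from one operation to the next, so only their
  existence is an invariant.\<close>

lemma scaled_matrix_minor:
  assumes "matrix_minor R A A'" and "\<exists>r s a. scaled_matrix R h r s a A"
  shows "\<exists>r s a. scaled_matrix R h r s a A'"
  using assms
proof induction
  case refl
  then show ?case .
next
  case (scale_row S T D x c)
  then obtain r s a where *: "scaled_matrix R h r s a (S, T, D)" by auto
  have "scaled_matrix R h (r(x := c \<otimes> r x)) s a (S, T, \<lambda>u v. if u = x then c \<otimes> D u v else D u v)"
    using * scale_row(2,3) by (auto simp: scaled_matrix_def Units_closed m_assoc)
  then show ?case by blast
next
  case (scale_col S T D y c)
  then obtain r s a where *: "scaled_matrix R h r s a (S, T, D)" by auto
  have "scaled_matrix R h r (s(y := c \<otimes> s y)) a (S, T, \<lambda>u v. if v = y then c \<otimes> D u v else D u v)"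
    using * scale_col(2,3) by (auto simp: scaled_matrix_def Units_closed m_ac)
  then show ?case by blast
next
  case (delete_row S T D x)
  then obtain r s a where "scaled_matrix R h r s a (S, T, D)" by auto
  then have "scaled_matrix R h r s a (S - {x}, T, D)" by (auto simp: scaled_matrix_def)
  then show ?case by blast
next
  case (delete_col S T D y)
  then obtain r s a where "scaled_matrix R h r s a (S, T, D)" by auto
  then have "scaled_matrix R h r s a (S, T - {y}, D)" by (auto simp: scaled_matrix_def)
  then show ?case by blast
next
  case (permute_rows S T D \<pi>)
  then obtain r s a where "scaled_matrix R h r s a (S, T, D)" by auto
  then have "scaled_matrix R h (r \<circ> \<pi>) s (\<lambda>u. a (\<pi> u)) (S, T, \<lambda>u v. D (\<pi> u) v)"
    using permutes_in_image[OF permute_rows(2)] by (auto simp: scaled_matrix_def)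
  then show ?case by blast
next
  case (permute_cols S T D \<pi>)
  then obtain r s a where "scaled_matrix R h r s a (S, T, D)" by auto
  then have "scaled_matrix R h r (s \<circ> \<pi>) (\<lambda>u v. a u (\<pi> v)) (S, T, \<lambda>u v. D u (\<pi> v))"
    using permutes_in_image[OF permute_cols(2)] by (auto simp: scaled_matrix_def)
  then show ?case by blast
next
  case (pivot S T D x y)
  then obtain r s a where "scaled_matrix R h r s a (S, T, D)" by auto
  from scaled_matrix_pivot(2)[OF this pivot(2,3,4)] show ?case by blast
qed

text \<open>In a 2 by 2 matrix the product of one diagonal divided by that of the other is
  unaffected by row and column scaling. For the matrix defining the cross ratio this quotient is
  \<open>p\<close>; for the field matrix it is a field element.\<close>

lemma cross_ratios_subset:
  assumes "scaled_matrix R h r s a A"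
  shows "cross_ratios R A \<subseteq> range h"
proof
  fix p assume "p \<in> cross_ratios R A"
  then obtain x1 x2 y1 y2 D where M: "matrix_minor R A ({x1, x2}, {y1, y2}, D)"
    and one: "D x1 y1 = \<one>" "D x1 y2 = \<one>" "D x2 y2 = \<one>" and p: "D x2 y1 = p"
    by (auto simp: cross_ratios_def)
  obtain r s a where "scaled_matrix R h r s a ({x1, x2}, {y1, y2}, D)"
    using scaled_matrix_minor[OF M] assms by blast
  then have D: "D u v = r u \<otimes> h (a u v) \<otimes> s v" and rs [simp]: "r u \<in> carrier R" "s v \<in> carrier R"
    if "u \<in> {x1, x2}" "v \<in> {y1, y2}" for u v
    using that by (auto simp: scaled_matrix_def)
  have "h (a x1 y1) \<noteq> \<zero>" "h (a x2 y2) \<noteq> \<zero>"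
    using one(1,3) D[of x1 y1] D[of x2 y2] rs[of x1 y1] rs[of x2 y2] nontrivial by auto
  then have nz: "a x1 y1 \<noteq> 0" "a x2 y2 \<noteq> 0" by auto
  have "D x2 y1 \<otimes> h (a x1 y1) \<otimes> h (a x2 y2) \<otimes> D x1 y2 =
      D x1 y1 \<otimes> D x2 y2 \<otimes> h (a x2 y1) \<otimes> h (a x1 y2)"
    using rs[of x1 y1] rs[of x2 y2] by (simp add: D m_ac)
  moreover have "p \<in> carrier R"
    using rs[of x1 y1] rs[of x2 y2] by (simp add: D flip: p)
  ultimately have *: "p \<otimes> h (a x1 y1 * a x2 y2) = h (a x2 y1 * a x1 y2)"
    by (simp add: one p h_mult m_assoc)
  let ?q = "a x2 y1 * a x1 y2 / (a x1 y1 * a x2 y2)"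
  have "p \<otimes> h (a x1 y1 * a x2 y2) = h ?q \<otimes> h (a x1 y1 * a x2 y2)"
    using nz unfolding * by (simp flip: h_mult)
  then have "p = h ?q"
    using nz \<open>p \<in> carrier R\<close> by (metis h_Units h_closed m_comm mult_eq_0_iff Units_l_cancel)
  then show "p \<in> range h" by blast
qed

section \<open>Coordinate matrices and pivoting to a prescribed basis\<close>

text \<open>In a coordinate matrix every column records how its label is a linear combination of the
  row labels; pivoting is a change of basis.\<close>

definition coordinate_matrix ::
  "('e \<Rightarrow> 'a) \<Rightarrow> ('e \<Rightarrow> 'i \<Rightarrow> 'f) \<Rightarrow> ('e \<Rightarrow> 'e \<Rightarrow> 'f) \<Rightarrow> ('e, 'a) lmatrix \<Rightarrow> bool" where
  "coordinate_matrix t \<xi> a = (\<lambda>(S, T, D). finite S \<and> S \<inter> T = {} \<and>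
     (\<forall>u\<in>S \<union> T. t u \<in> Units R) \<and>
     (\<forall>u\<in>S. \<forall>v\<in>T. D u v = inv (t u) \<otimes> h (a u v) \<otimes> t v) \<and>
     (\<forall>v\<in>T. \<forall>i. \<xi> v i = (\<Sum>u\<in>S. a u v * \<xi> u i)))"

lemma coordinate_matrix_scaled:
  assumes "coordinate_matrix t \<xi> a A"
  shows "scaled_matrix R h (\<lambda>u. inv (t u)) t a A"
  by (cases A) (use assms in \<open>auto simp: coordinate_matrix_def scaled_matrix_def\<close>)

text \<open>Rows are scaled by \<open>inv (t u)\<close> and columns by \<open>t v\<close> with one
  and the same \<open>t\<close>. Exchanging the labels \<open>x\<close> and \<open>y\<close>
  therefore leaves both families of scales as they are, and only the field matrix changes.\<close>

lemma coordinate_matrix_pivot: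
  assumes A: "coordinate_matrix t \<xi> a (S, T, D)" and x: "x \<in> S" and y: "y \<in> T"
    and nz: "D x y \<noteq> \<zero>"
  shows "coordinate_matrix t \<xi> (field_pivot x y a) (pivot R x y (S, T, D))"
proof -
  have fin: "finite S" and disj: "S \<inter> T = {}" and t: "\<And>u. u \<in> S \<union> T \<Longrightarrow> t u \<in> Units R"
    and \<xi>: "\<And>v i. v \<in> T \<Longrightarrow> \<xi> v i = (\<Sum>u\<in>S. a u v * \<xi> u i)"
    using A by (auto simp: coordinate_matrix_def)
  have sc: "scaled_matrix R h (\<lambda>u. inv (t u)) t a (S, T, D)"
    by (rule coordinate_matrix_scaled[OF A])
  note axy = scaled_matrix_pivot(1)[OF sc x y nz]
  have "scaled_matrix R h (\<lambda>u. inv (t u)) t (field_pivot x y a) (pivot R x y (S, T, D))"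
    using scaled_matrix_pivot(2)[OF sc x y nz] t[of x] x by simp (simp add: fun_upd_idem)
  moreover obtain D' where D': "pivot R x y (S, T, D) = (insert y (S - {x}), insert x (T - {y}), D')"
    by (simp add: pivot_def)
  have split: "\<xi> v i = a x v * \<xi> x i + (\<Sum>u\<in>S - {x}. a u v * \<xi> u i)" if "v \<in> T" for v i
    using \<xi>[OF that, of i] sum.remove[OF fin x, of "\<lambda>u. a u v * \<xi> u i"] by simp
  have y': "y \<notin> S - {x}" and xy: "x \<noteq> y" using disj x y by auto
  have "\<xi> v i = (\<Sum>u\<in>insert y (S - {x}). field_pivot x y a u v * \<xi> u i)"
    if v: "v \<in> insert x (T - {y})" for v i
  proof -
    have sum: "(\<Sum>u\<in>insert y (S - {x}). field_pivot x y a u v * \<xi> u i) =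
        field_pivot x y a y v * \<xi> y i + (\<Sum>u\<in>S - {x}. field_pivot x y a u v * \<xi> u i)"
      using fin y' by simp
    show ?thesis
    proof (cases "v = x")
      case True
      \<comment> \<open>Column \<open>x\<close> is the old expansion of \<open>y\<close>, solved for
        \<open>x\<close>.\<close>
      have "(\<Sum>u\<in>S - {x}. field_pivot x y a u x * \<xi> u i) =
          (\<Sum>u\<in>S - {x}. - (1 / a x y) * (a u y * \<xi> u i))"
        using y' by (intro sum.cong) (auto simp: field_pivot_def)
      also have "\<dots> = - (1 / a x y) * (\<xi> y i - a x y * \<xi> x i)"
        unfolding sum_distrib_left[symmetric] split[OF y] by simp
      finally show ?thesis
        using axy unfolding True sum[unfolded True] by (simp add: field_pivot_def field_simps)
    next
      case False
      then have vT: "v \<in> T" "v \<noteq> y" using v by auto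
      \<comment> \<open>The expansion of \<open>x\<close> just found is substituted into the old
        expansion of \<open>v\<close>.\<close>
      have "(\<Sum>u\<in>S - {x}. field_pivot x y a u v * \<xi> u i) =
          (\<Sum>u\<in>S - {x}. a u v * \<xi> u i - (a x v / a x y) * (a u y * \<xi> u i))"
        using y' False by (intro sum.cong) (auto simp: field_pivot_def algebra_simps)
      also have "\<dots> = \<xi> v i - a x v * \<xi> x i - (a x v / a x y) * (\<xi> y i - a x y * \<xi> x i)"
        unfolding sum_subtractf sum_distrib_left[symmetric] split[OF vT(1)] split[OF y] by simp
      finally show ?thesis
        using axy False unfolding sum by (simp add: field_pivot_def field_simps)
    qed
  qed
  ultimately show ?thesis
    unfolding D' using fin disj t x y by (auto simp: coordinate_matrix_def scaled_matrix_def)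
qed

text \<open>Steinitz exchange: each pivot brings a missing label of \<open>F\<close> into the rows
  in return for one outside \<open>F\<close>. It makes the unknown starting basis harmless, since a
  family of labels chosen in advance can be moved into the rows.\<close>

lemma pivot_to_basis:
  assumes "matrix_minor R A (S, T, D)" "coordinate_matrix t \<xi> a (S, T, D)" "F \<subseteq> S \<union> T"
    and indep: "\<And>f c. f \<in> F \<Longrightarrow> \<exists>i. \<xi> f i \<noteq> (\<Sum>u\<in>F - {f}. c u * \<xi> u i)"
    and fin: "finite F"
  shows "\<exists>S' T' D' a'. matrix_minor R A (S', T', D') \<and> coordinate_matrix t \<xi> a' (S', T', D') \<and>
    F \<subseteq> S' \<and> S' \<union> T' = S \<union> T \<and> card S' = card S"
  using assms(1-3)
proof (induction "card (F - S)" arbitrary: S T D a rule: less_induct)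
  case less
  show ?case
  proof (cases "F \<subseteq> S")
    case True
    then show ?thesis using less.prems by blast
  next
    case False
    then obtain f where f: "f \<in> F" "f \<notin> S" by blast
    then have fT: "f \<in> T" using less.prems(3) by blast
    have finS: "finite S" and disj: "S \<inter> T = {}" and t: "\<And>u. u \<in> S \<union> T \<Longrightarrow> t u \<in> Units R"
      and D: "\<And>u v. u \<in> S \<Longrightarrow> v \<in> T \<Longrightarrow> D u v = inv (t u) \<otimes> h (a u v) \<otimes> t v"
      and \<xi>: "\<And>v i. v \<in> T \<Longrightarrow> \<xi> v i = (\<Sum>u\<in>S. a u v * \<xi> u i)"
      using less.prems(2) by (auto simp: coordinate_matrix_def)
    have "\<exists>x\<in>S - F. a x f \<noteq> 0"
    proof (rule ccontr)
      assume "\<not> ?thesis"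
      then have z: "a u f = 0" if "u \<in> S - F" for u using that by blast
      \<comment> \<open>The entries of \<open>a\<close> are meaningful only for row labels, so
        labels of \<open>F\<close> outside \<open>S\<close> get coefficient zero. The vanishing just
        assumed removes the row labels outside \<open>F\<close>, and \<open>f\<close> would depend
        on the rest of \<open>F\<close>.\<close>
      let ?c = "\<lambda>u. if u \<in> S then a u f else 0"
      have "\<xi> f i = (\<Sum>u\<in>F - {f}. ?c u * \<xi> u i)" for i
      proof -
        have "\<xi> f i = (\<Sum>u\<in>S \<inter> (F - {f}). a u f * \<xi> u i)"
          unfolding \<xi>[OF fT] by (rule sum.mono_neutral_right) (use finS f z in auto)
        also have "\<dots> = (\<Sum>u\<in>F - {f}. ?c u * \<xi> u i)"
          by (rule sum.mono_neutral_cong_left) (use fin in auto)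
        finally show ?thesis .
      qed
      then show False using indep[OF f(1), of ?c] by blast
    qed
    then obtain x where x: "x \<in> S" "x \<notin> F" "a x f \<noteq> 0" by blast
    have "D x f \<in> Units R"
      unfolding D[OF x(1) fT] using t[of x] t[of f] x fT by simp
    then have nz: "D x f \<noteq> \<zero>" using zero_not_unit by auto
    obtain D' where D': "pivot R x f (S, T, D) = (insert f (S - {x}), insert x (T - {f}), D')"
      by (simp add: pivot_def)
    have "F - insert f (S - {x}) \<subset> F - S" using f x by blast
    then have "card (F - insert f (S - {x})) < card (F - S)"
      using fin by (intro psubset_card_mono) auto
    moreover have "matrix_minor R A (insert f (S - {x}), insert x (T - {f}), D')"
      using matrix_minor.pivot[OF less.prems(1) x(1) fT nz] by (simp add: D')
    moreover have "coordinate_matrix t \<xi> (field_pivot x f a) (insert f (S - {x}), insert x (T - {f}), D')"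
      using coordinate_matrix_pivot[OF less.prems(2) x(1) fT nz] by (simp add: D')
    moreover have un: "insert f (S - {x}) \<union> insert x (T - {f}) = S \<union> T"
      using x fT f by auto
    moreover have "card (insert f (S - {x})) = card S"
      using card_insert_disjoint[of "S - {x}" f] card.remove[OF finS x(1)] finS f(2) by auto
    ultimately show ?thesis
      using less.hyps[of "insert f (S - {x})" "insert x (T - {f})" D' "field_pivot x f a"] less.prems(3)
      by metis
  qed
qed

lemma matrix_minor_delete_cols:
  assumes "matrix_minor R A (S, T, D)" "finite U" "U \<subseteq> T"
  shows "matrix_minor R A (S, T - U, D)"
  using assms(2,1,3)
proof (induction U rule: finite_induct)
  case (insert y U)
  then have "matrix_minor R A (S, T - U - {y}, D)"
    by (intro matrix_minor.delete_col) auto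
  then show ?case unfolding Diff_insert[of T y U] .
qed simp

text \<open>After deletion to two rows and two columns, the scales \<open>t f1\<close>,
  \<open>t f2\<close>, \<open>inv (t v)\<close>, \<open>inv (t w)\<close> strip off the diagonal
  factors, and the images of the field entries remain.\<close>

lemma cross_ratio_of_coordinates:
  assumes M: "matrix_minor R A ({f1, f2, f3}, T, D)"
    and C: "coordinate_matrix t \<xi> a ({f1, f2, f3}, T, D)"
    and "finite T" and f: "distinct [f1, f2, f3]" and vw: "v \<in> T" "w \<in> T" "v \<noteq> w"
    and a: "a f1 v = 1" "a f1 w = 1" "a f2 v = p" "a f2 w = 1"
  shows "h p \<in> cross_ratios R A"
proof -
  have t: "t f1 \<in> Units R" "t f2 \<in> Units R" "t v \<in> Units R" "t w \<in> Units R"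
    and D: "D f1 v = inv (t f1) \<otimes> t v" "D f1 w = inv (t f1) \<otimes> t w"
      "D f2 v = inv (t f2) \<otimes> (t v \<otimes> h p)" "D f2 w = inv (t f2) \<otimes> t w"
    using C vw a by (auto simp: coordinate_matrix_def Units_closed m_ac)
  have "matrix_minor R A ({f1, f2, f3} - {f3}, T, D)"
    by (rule matrix_minor.delete_row[OF M]) simp
  also have "{f1, f2, f3} - {f3} = {f1, f2}" using f by auto
  finally have "matrix_minor R A ({f1, f2}, T - (T - {v, w}), D)"
    using \<open>finite T\<close> by (intro matrix_minor_delete_cols) auto
  also have "T - (T - {v, w}) = {v, w}" using vw by auto
  finally have "matrix_minor R A ({f1, f2}, {v, w}, D)" .
  note this[THEN matrix_minor.scale_row, of f1 "t f1", simplified, OF t(1),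
      THEN matrix_minor.scale_row, of f2 "t f2", simplified, OF t(2),
      THEN matrix_minor.scale_col, of v "inv (t v)", simplified, OF Units_inv_Units[OF t(3)],
      THEN matrix_minor.scale_col, of w "inv (t w)", simplified, OF Units_inv_Units[OF t(4)]]
  note minor = this
  have f: "f1 \<noteq> f2" "f2 \<noteq> f1" using f by auto
  \<comment> \<open>The witness matrix stays schematic until \<open>minor\<close> fixes it as the
    result of the four scalings.\<close>
  show ?thesis
    unfolding cross_ratios_def mem_Collect_eq
    by (rule exI[of _ f1], rule exI[of _ f2], rule exI[of _ v], rule exI[of _ w], rule exI,
        intro conjI, use f in simp, use vw in simp, rule minor)
      (use f vw vw(3)[symmetric] t Units_closed[OF t(1)] Units_closed[OF t(2)] Units_closed[OF t(3)] Units_closed[OF t(4)]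
        in \<open>simp_all add: D inv_cancel\<close>)
qed

end

section \<open>Universal partial fields isomorphic to a field\<close>

lemma partial_field_field_pfield: "partial_field (field_pfield :: ('f::field) pfield)"
proof -
  interpret F: cring "ring_of_type_algebra :: 'f ring" by (rule cring_from_type_algebra)
  have U: "Units (ring_of_type_algebra :: 'f ring) = UNIV - {0}"
    by (auto simp: Units_def intro: exI[of _ "1 / _"])
  have "subgroup (UNIV - {0}) (units_of (ring_of_type_algebra :: 'f ring))"
    using group.subgroup_self[OF F.units_group] by (simp add: units_of_carrier U)
  moreover have "\<ominus>\<^bsub>ring_of_type_algebra\<^esub> (1 :: 'f) \<noteq> 0"
    using F.r_neg[of 1] by auto
  ultimately show ?thesis
    by (simp add: partial_field_def field_pfield_def F.is_cring)
qed

text \<open>The cross ratios are squeezed between the images of all elements other than zero and one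
  and the full image of \<open>h\<close>. Both generate the same objects, because zero and one lie
  in every generated subring and one in every generated subgroup.\<close>

theorem universal_partial_field_isomorphic_field:
  fixes h :: "'f::field \<Rightarrow> 'e bracket int_mpoly set"
  assumes h: "h \<in> ring_hom ring_of_type_algebra (bracket_ring M)"
    and nontrivial: "\<one>\<^bsub>bracket_ring M\<^esub> \<noteq> \<zero>\<^bsub>bracket_ring M\<^esub>"
    and sub: "matroid_cross_ratios M \<subseteq> range h"
    and sup: "\<And>p. p \<noteq> 0 \<Longrightarrow> p \<noteq> 1 \<Longrightarrow> h p \<in> matroid_cross_ratios M"
  shows "pf_isomorphic (universal_partial_field M) (field_pfield :: 'f pfield)"
proof -
  interpret B: cring "bracket_ring M" by (rule cring_bracket_ring)
  interpret B: field_hom "bracket_ring M" h by unfold_locales (rule h, rule nontrivial)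
  interpret h: ring_hom_ring ring_of_type_algebra "bracket_ring M" h
    by (intro ring_hom_ringI2 ring_from_type_algebra B.ring_axioms h)
  let ?Cr = "matroid_cross_ratios M"
  have carr: "range h \<subseteq> carrier (bracket_ring M)" by auto
  have subr: "subring (range h) (bracket_ring M)"
    using h.img_is_subring[OF h.R.carrier_is_subring] by simp
  have gen: "generate_ring (bracket_ring M) ?Cr = range h"
  proof
    show "generate_ring (bracket_ring M) ?Cr \<subseteq> range h"
      using sub carr by (intro B.generate_ring_min_subring1 subr) auto
    show "range h \<subseteq> generate_ring (bracket_ring M) ?Cr"
    proof safe
      fix p
      show "h p \<in> generate_ring (bracket_ring M) ?Cr"
        by (cases "p = 0"; cases "p = 1")
          (auto simp: B.zero_in_generate generate_ring.one sup intro: generate_ring.incl)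
    qed
  qed
  define R where "R = universal_ring M"
  have R_ops: "carrier R = range h" "x \<otimes>\<^bsub>R\<^esub> y = x \<otimes>\<^bsub>bracket_ring M\<^esub> y"
    "x \<oplus>\<^bsub>R\<^esub> y = x \<oplus>\<^bsub>bracket_ring M\<^esub> y" "\<one>\<^bsub>R\<^esub> = \<one>\<^bsub>bracket_ring M\<^esub>"
    "\<zero>\<^bsub>R\<^esub> = \<zero>\<^bsub>bracket_ring M\<^esub>" for x y
    by (simp_all add: R_def universal_ring_def gen)
  have "cring R"
    unfolding R_def universal_ring_def gen using h.img_is_cring[OF B.is_cring] by simp
  then interpret R: cring R .
  \<comment> \<open>The group of the partial field consists of units of the subring
    \<open>R\<close>, so inverses must exist in \<open>R\<close> itself and not only in the bracket
    ring.\<close>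
  interpret R: field_hom R h
    by unfold_locales
      (auto simp: R_ops B.h_mult B.h_add nontrivial intro!: ring_hom_memI)
  interpret G: comm_group "units_of R" by (rule R.units_comm_group)
  define H where "H = h ` (UNIV - {0})"
  have HU: "H \<subseteq> carrier (units_of R)"
    unfolding H_def units_of_carrier using R.h_Units by blast
  have H: "subgroup H (units_of R)"
  proof (rule G.subgroupI[OF HU])
    have "(1 :: 'f) \<in> UNIV - {0}" by simp
    then show "H \<noteq> {}" unfolding H_def by blast
    show "inv\<^bsub>units_of R\<^esub> x \<in> H" if "x \<in> H" for x
      using that by (auto simp: H_def R.units_of_inv R.h_inv)
    show "x \<otimes>\<^bsub>units_of R\<^esub> y \<in> H" if "x \<in> H" "y \<in> H" for x y
      using that by (auto simp: H_def units_of_mult simp flip: R.h_mult)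
  qed
  define gens where "gens = (?Cr \<union> {\<ominus>\<^bsub>R\<^esub> \<one>\<^bsub>R\<^esub>}) - {\<zero>\<^bsub>R\<^esub>}"
  have minus_one: "\<ominus>\<^bsub>R\<^esub> \<one>\<^bsub>R\<^esub> = h (- 1)" by (simp only: R.h_uminus R.h_one)
  have gensH: "gens \<subseteq> H"
  proof
    fix x assume "x \<in> gens"
    then have "x \<in> range h" and nz: "x \<noteq> \<zero>\<^bsub>R\<^esub>"
      using sub by (auto simp only: gens_def minus_one)
    then obtain p where p: "x = h p" by blast
    with nz have "p \<noteq> 0" using R.h_zero by metis
    with p show "x \<in> H" unfolding H_def by blast
  qed
  have G: "generate (units_of R) gens = H"
  proof
    show "generate (units_of R) gens \<subseteq> H"
      by (rule G.generate_subgroup_incl[OF gensH H])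
    show "H \<subseteq> generate (units_of R) gens"
    proof
      fix x assume "x \<in> H"
      then obtain p where p: "x = h p" "p \<noteq> 0" by (auto simp: H_def)
      show "x \<in> generate (units_of R) gens"
      proof (cases "p = 1")
        case True
        then show ?thesis
          using generate.one[of "units_of R" gens] p by (simp only: units_of_one R.h_one)
      next
        case False
        then have "x \<in> gens" using p sup by (simp add: gens_def)
        then show ?thesis by (rule generate.incl)
      qed
    qed
  qed
  have upf: "universal_partial_field M = (R, H)"
    unfolding universal_partial_field_def Let_def R_def[symmetric] gens_def[symmetric] G ..
  have "pf_elems (R, H) = insert (h 0) (h ` (UNIV - {0}))"
    by (simp only: pf_elems_def prod.case H_def R.h_zero)
  then have elems: "pf_elems (R, H) = range h"
    by (simp only: image_insert[symmetric] insert_Diff[OF UNIV_I])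
  have elems_field: "pf_elems (field_pfield :: 'f pfield) = UNIV"
    by (auto simp: pf_elems_def field_pfield_def)
  have pf: "partial_field (R, H)"
    using H by (auto simp: partial_field_def R.is_cring H_def minus_one)
  define \<phi> where "\<phi> = inv_into UNIV h"
  have \<phi>: "\<phi> (h a) = a" for a
    by (simp add: \<phi>_def R.h_inj)
  have \<phi>_mult: "\<phi> (x \<otimes>\<^bsub>R\<^esub> y) = \<phi> x * \<phi> y" and \<phi>_add: "\<phi> x + \<phi> y = \<phi> (x \<oplus>\<^bsub>R\<^esub> y)"
    and sum_closed: "x \<oplus>\<^bsub>R\<^esub> y \<in> range h"
    if xy: "x \<in> range h" "y \<in> range h" for x y
  proof -
    obtain p q where pq: "x = h p" "y = h q" using xy by blast
    show "\<phi> (x \<otimes>\<^bsub>R\<^esub> y) = \<phi> x * \<phi> y"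
      unfolding pq R.h_mult[symmetric] \<phi> ..
    show "\<phi> x + \<phi> y = \<phi> (x \<oplus>\<^bsub>R\<^esub> y)"
      unfolding pq R.h_add[symmetric] \<phi> ..
    show "x \<oplus>\<^bsub>R\<^esub> y \<in> range h"
      unfolding pq R.h_add[symmetric] by blast
  qed
  let ?F = "(ring_of_type_algebra :: 'f ring, UNIV - {0})"
  note field = partial_field_field_pfield[where 'f = 'f, unfolded field_pfield_def]
    elems_field[unfolded field_pfield_def]
  have "\<phi> \<in> pf_hom (R, H) ?F"
    unfolding pf_hom_def prod.case mem_Collect_eq elems field(2) ring_of_type_algebra_simps
    using pf field(1) \<phi>[of 1, unfolded R.h_one] \<phi>_mult \<phi>_add by blast
  moreover have "bij_betw \<phi> (range h) UNIV"
    by (rule bij_betw_byWitness[where f' = h]) (auto simp: \<phi>)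
  \<comment> \<open>Both sets of elements are closed under addition, so both sides of the
    equivalence for sums always hold.\<close>
  ultimately have "\<phi> \<in> pf_iso (R, H) ?F"
    unfolding pf_iso_def prod.case mem_Collect_eq elems field(2) using sum_closed by blast
  then have "\<phi> \<in> pf_iso (R, H) field_pfield"
    unfolding field_pfield_def .
  then show ?thesis unfolding pf_isomorphic_def upf by blast
qed

section \<open>Three lines and a point in the projective plane\<close>

lemma vec3_dim_UNIV: "vec.dim (UNIV :: ('f::field ^ 3) set) = 3"
  by (subst vec_dim_card) simp

lemma vec3_span_UNIV_iff: "vec.span S = UNIV \<longleftrightarrow> vec.dim S = 3" for S :: "('f::field ^ 3) set"
  unfolding vec.dim_eq_full[symmetric] vec.dimension_def card_cart_basis by simp

lemma vec_span_scale:
  fixes v :: "'f::field ^ 3"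
  assumes "c \<noteq> 0"
  shows "vec.span {c *s v} = vec.span {v}"
proof -
  have "v = (1 / c) *s (c *s v)" using assms by simp
  then have "v \<in> vec.span {c *s v}"
    by (metis vec.span_base vec.span_scale singletonI)
  moreover have "c *s v \<in> vec.span {v}"
    by (intro vec.span_scale vec.span_base) simp
  ultimately show ?thesis by (simp add: vec.span_eq)
qed

lemma pg_points_iff: "P \<in> pg_points \<longleftrightarrow> (\<exists>v. v \<noteq> 0 \<and> P = vec.span {v})"
proof
  assume P: "P \<in> pg_points"
  then have sub: "vec.subspace P" and d: "vec.dim P = 1"
    by (auto simp: pg_points_def)
  obtain B where B: "B \<subseteq> P" "vec.independent B" "P \<subseteq> vec.span B" "card B = vec.dim P"
    using vec.basis_exists by blast
  then obtain v where v: "B = {v}" using d by (auto simp: card_1_singleton_iff)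
  have "v \<noteq> 0" using B(2) v by auto
  moreover have "P = vec.span {v}"
    using B v vec.span_minimal[OF _ sub, of B] by auto
  ultimately show "\<exists>v. v \<noteq> 0 \<and> P = vec.span {v}" by blast
next
  assume "\<exists>v. v \<noteq> 0 \<and> P = vec.span {v}"
  then show "P \<in> pg_points"
    by (auto simp: pg_points_def)
qed

lemma planes_meet:
  fixes U V :: "('f::field ^ 3) set"
  assumes "vec.subspace U" "vec.subspace V" "vec.dim U = 2" "vec.dim V = 2"
  obtains u where "u \<noteq> 0" "u \<in> U" "u \<in> V"
proof -
  have "vec.dim {x + y |x y. x \<in> U \<and> y \<in> V} \<le> 3"
    using vec.dim_subset[OF subset_UNIV[of "{x + y |x y. x \<in> U \<and> y \<in> V}"]]
    by (simp only: vec3_dim_UNIV)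
  then have "vec.dim (U \<inter> V) \<noteq> 0"
    using vec.dim_sums_Int[OF assms(1,2)] assms(3,4) by linarith
  then have "\<not> U \<inter> V \<subseteq> {0}" by simp
  then show thesis using that by blast
qed

lemma span_subset_subspace_iff:
  "vec.subspace W \<Longrightarrow> vec.span {v} \<subseteq> W \<longleftrightarrow> v \<in> W"
  using vec.span_minimal[of "{v}" W] vec.span_base[of v "{v}"] by blast

text \<open>The corners are vectors and not points, so rescaling them gives another instance with
  the same planes. This freedom is used at the end to move \<open>e\<close> to
  \<open>(1, 1, 1)\<close>.\<close>

locale triangle =
  fixes W1 W2 W3 :: "('f::field ^ 3) set" and u1 u2 u3 :: "'f ^ 3"
  assumes subspaces: "vec.subspace W1" "vec.subspace W2" "vec.subspace W3"
    and corners: "u1 \<in> W2" "u1 \<in> W3" "u2 \<in> W1" "u2 \<in> W3" "u3 \<in> W1" "u3 \<in> W2"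
    and opposite: "u1 \<notin> W1" "u2 \<notin> W2" "u3 \<notin> W3"
begin

fun lin :: "'f triple \<Rightarrow> 'f ^ 3" where
  "lin (x1, x2, x3) = x1 *s u1 + x2 *s u2 + x3 *s u3"

abbreviation pt :: "'f triple \<Rightarrow> 'f pg_point" where
  "pt x \<equiv> vec.span {lin x}"

lemma scale_mem_iff:
  "vec.subspace W \<Longrightarrow> c *s v \<in> W \<longleftrightarrow> c = 0 \<or> v \<in> W" for v :: "'f ^ 3"
  using vec.subspace_scale[of W "c *s v" "1 / c"] vec.subspace_scale[of W v c] vec.subspace_0[of W]
  by (cases "c = 0") auto

text \<open>Each plane contains two of the corners, so modulo the plane only the multiple of the
  opposite corner survives.\<close>

lemma lin_mem_iff:
  "lin (x1, x2, x3) \<in> W1 \<longleftrightarrow> x1 = 0"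
  "lin (x1, x2, x3) \<in> W2 \<longleftrightarrow> x2 = 0"
  "lin (x1, x2, x3) \<in> W3 \<longleftrightarrow> x3 = 0"
proof -
  have *: "p + q \<in> W \<longleftrightarrow> p \<in> W" if "vec.subspace W" "q \<in> W" for p q and W :: "('f ^ 3) set"
    using vec.subspace_add[of W p q] vec.subspace_diff[of W "p + q" q] that by auto
  have "lin (x1, x2, x3) = x1 *s u1 + (x2 *s u2 + x3 *s u3)"
    "lin (x1, x2, x3) = x2 *s u2 + (x1 *s u1 + x3 *s u3)"
    "lin (x1, x2, x3) = x3 *s u3 + (x1 *s u1 + x2 *s u2)"
    by (simp_all add: add_ac)
  note decomp = this
  have "x2 *s u2 + x3 *s u3 \<in> W1" "x1 *s u1 + x3 *s u3 \<in> W2" "x1 *s u1 + x2 *s u2 \<in> W3"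
    using corners subspaces by (auto intro!: vec.subspace_add vec.subspace_scale)
  then show "lin (x1, x2, x3) \<in> W1 \<longleftrightarrow> x1 = 0" "lin (x1, x2, x3) \<in> W2 \<longleftrightarrow> x2 = 0"
    "lin (x1, x2, x3) \<in> W3 \<longleftrightarrow> x3 = 0"
    by (simp_all only: decomp(1)[THEN arg_cong, of "\<lambda>v. v \<in> W1"] decomp(2)[THEN arg_cong, of "\<lambda>v. v \<in> W2"]
        decomp(3)[THEN arg_cong, of "\<lambda>v. v \<in> W3"] * subspaces scale_mem_iff opposite simp_thms)
qed

lemma lin_eq_0_iff: "lin x = 0 \<longleftrightarrow> x = (0, 0, 0)"
proof
  assume "lin x = 0"
  then show "x = (0, 0, 0)"
    using lin_mem_iff subspaces[THEN vec.subspace_0] by (cases x) (metis lin_mem_iff)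
qed simp

lemma lin_diff: "lin (x1, x2, x3) - lin (y1, y2, y3) = lin (x1 - y1, x2 - y2, x3 - y3)"
  by (simp add: vector_ssub_ldistrib vec.scale_left_diff_distrib algebra_simps)

lemma lin_eq_iff: "lin x = lin y \<longleftrightarrow> x = y"
proof
  assume "lin x = lin y"
  then have "lin x - lin y = 0" by simp
  then show "x = y"
    by (cases x; cases y) (simp only: lin_diff lin_eq_0_iff, simp)
qed simp

lemma lin_scale: "c *s lin (x1, x2, x3) = lin (c * x1, c * x2, c * x3)"
  by (simp add: vec.scale_right_distrib)

lemma independent_corners: "vec.independent {u1, u2, u3}" "card {u1, u2, u3} = 3"
proof -
  have d: "u1 \<noteq> u2" "u1 \<noteq> u3" "u2 \<noteq> u3" using corners opposite by auto
  then show "card {u1, u2, u3} = 3" by simp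
  have "u3 \<noteq> 0" using opposite(3) vec.subspace_0[OF subspaces(3)] by auto
  moreover have "u2 \<notin> vec.span {u3}"
    using opposite(2) corners(6) vec.span_minimal[of "{u3}" W2] subspaces by auto
  moreover have "u1 \<notin> vec.span {u2, u3}"
    using opposite(1) corners vec.span_minimal[of "{u2, u3}" W1] subspaces by auto
  ultimately show "vec.independent {u1, u2, u3}"
    by (simp add: vec.independent_insert d)
qed

lemma span3_iff: "w \<in> vec.span {p, q, r} \<longleftrightarrow> (\<exists>a b c. w = a *s p + b *s q + c *s r)"
  for w :: "'f ^ 3"
  by (auto simp: vec.span_insert vec.span_singleton algebra_simps)

lemma lin_surj: obtains x where "v = lin x"
proof -
  have "UNIV \<subseteq> vec.span {u1, u2, u3}"
    by (rule vec.card_ge_dim_independent)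
      (simp_all only: independent_corners vec3_dim_UNIV subset_UNIV order.refl simp_thms)
  then have "v \<in> vec.span {u1, u2, u3}" by blast
  then show thesis using that unfolding span3_iff by (metis lin.simps)
qed

text \<open>One direction is Cramer's rule. In the other, the coefficients that express the unit
  triples form a left inverse, and multiplicativity of the determinant gives a product equal to
  one.\<close>

lemma det3_nonzero_iff_dim: "det3 x y z \<noteq> 0 \<longleftrightarrow> vec.dim {lin x, lin y, lin z} = 3"
proof -
  obtain x1 x2 x3 y1 y2 y3 z1 z2 z3 where
    [simp]: "x = (x1, x2, x3)" "y = (y1, y2, y3)" "z = (z1, z2, z3)"
    by (metis prod.exhaust)
  have comb: "a *s lin x + b *s lin y + c *s lin z =
      lin (a * x1 + b * y1 + c * z1, a * x2 + b * y2 + c * z2, a * x3 + b * y3 + c * z3)" for a b c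
    by (simp add: vec.scale_left_distrib vec.scale_right_distrib algebra_simps)
  show ?thesis
  proof
    assume d: "det3 x y z \<noteq> 0"
    have "w \<in> vec.span {lin x, lin y, lin z}" for w
    proof -
      obtain w1 w2 w3 where w: "w = lin (w1, w2, w3)" using lin_surj by (metis prod.exhaust)
      let ?w = "(w1, w2, w3)" and ?d = "det3 x y z"
      have "det3 ?w y z * x1 + det3 x ?w z * y1 + det3 x y ?w * z1 = ?d * w1"
        "det3 ?w y z * x2 + det3 x ?w z * y2 + det3 x y ?w * z2 = ?d * w2"
        "det3 ?w y z * x3 + det3 x ?w z * y3 + det3 x y ?w * z3 = ?d * w3"
        by (simp_all add: algebra_simps)
      then have "w = (det3 ?w y z / ?d) *s lin x + (det3 x ?w z / ?d) *s lin y + (det3 x y ?w / ?d) *s lin z"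
        unfolding comb w lin_eq_iff using d
        by (simp del: det3.simps \<open>x = _\<close> \<open>y = _\<close> \<open>z = _\<close> add: add_divide_distrib[symmetric])
      then show ?thesis unfolding span3_iff by blast
    qed
    then have "vec.span {lin x, lin y, lin z} = UNIV" by blast
    then show "vec.dim {lin x, lin y, lin z} = 3"
      by (simp only: vec3_span_UNIV_iff)
  next
    assume d: "vec.dim {lin x, lin y, lin z} = 3"
    have "vec.span {lin x, lin y, lin z} = UNIV"
      using d by (simp only: vec3_span_UNIV_iff)
    then have sp: "lin w \<in> vec.span {lin x, lin y, lin z}" for w by simp
    have sp': "\<exists>a b c. w = (a * x1 + b * y1 + c * z1, a * x2 + b * y2 + c * z2, a * x3 + b * y3 + c * z3)" for w
      using sp[of w] unfolding span3_iff comb lin_eq_iff .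
    obtain a1 b1 c1 where 1: "E1 = (a1 * x1 + b1 * y1 + c1 * z1, a1 * x2 + b1 * y2 + c1 * z2, a1 * x3 + b1 * y3 + c1 * z3)"
      using sp'[of E1] by blast
    obtain a2 b2 c2 where 2: "E2 = (a2 * x1 + b2 * y1 + c2 * z1, a2 * x2 + b2 * y2 + c2 * z2, a2 * x3 + b2 * y3 + c2 * z3)"
      using sp'[of E2] by blast
    obtain a3 b3 c3 where 3: "E3 = (a3 * x1 + b3 * y1 + c3 * z1, a3 * x2 + b3 * y2 + c3 * z2, a3 * x3 + b3 * y3 + c3 * z3)"
      using sp'[of E3] by blast
    have "det3 (a1 * x1 + b1 * y1 + c1 * z1, a1 * x2 + b1 * y2 + c1 * z2, a1 * x3 + b1 * y3 + c1 * z3)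
      (a2 * x1 + b2 * y1 + c2 * z1, a2 * x2 + b2 * y2 + c2 * z2, a2 * x3 + b2 * y3 + c2 * z3)
      (a3 * x1 + b3 * y1 + c3 * z1, a3 * x2 + b3 * y2 + c3 * z2, a3 * x3 + b3 * y3 + c3 * z3) =
      det3 (a1, b1, c1) (a2, b2, c2) (a3, b3, c3) * det3 x y z"
      by (simp add: algebra_simps)
    then have "det3 (a1, b1, c1) (a2, b2, c2) (a3, b3, c3) * det3 x y z = 1"
      unfolding 1[symmetric] 2[symmetric] 3[symmetric] by simp
    then show "det3 x y z \<noteq> 0" by auto
  qed
qed

lemma det3_nonzero_iff_points:
  "det3 x y z \<noteq> 0 \<longleftrightarrow> vec.dim (\<Union>{pt x, pt y, pt z}) = 3"
proof -
  have "vec.span (\<Union>{pt x, pt y, pt z}) = vec.span {lin x, lin y, lin z}"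
    by (auto simp: vec.span_eq intro: vec.span_base vec.span_mono[THEN subsetD, rotated])
  then show ?thesis
    unfolding det3_nonzero_iff_dim by (metis vec.dim_span)
qed

lemma pt_mem: "x \<noteq> (0, 0, 0) \<Longrightarrow> pt x \<in> pg_points"
  unfolding pg_points_iff using lin_eq_0_iff by blast

lemma pt_scale: "c \<noteq> 0 \<Longrightarrow> pt (c * x1, c * x2, c * x3) = pt (x1, x2, x3)"
  unfolding lin_scale[symmetric] by (rule vec_span_scale)

lemma point_coords:
  assumes "P \<in> pg_points"
  obtains x where "P = pt x" "x \<noteq> (0, 0, 0)"
  using assms unfolding pg_points_iff by (metis lin_surj lin_eq_0_iff)

lemma pt_subset_iff:
  "pt (x1, x2, x3) \<subseteq> W1 \<longleftrightarrow> x1 = 0"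
  "pt (x1, x2, x3) \<subseteq> W2 \<longleftrightarrow> x2 = 0"
  "pt (x1, x2, x3) \<subseteq> W3 \<longleftrightarrow> x3 = 0"
  by (simp_all add: span_subset_subspace_iff subspaces lin_mem_iff del: lin.simps)

lemma frame_coords_nonzero: "x \<in> frame_coords \<Longrightarrow> x \<noteq> (0, 0, 0)" for x :: "'f triple"
  by (auto elim!: frame_coordsE)

lemma normalize_coords:
  assumes "x \<noteq> (0, 0, 0)" "x1 = 0 \<or> x2 = 0 \<or> x3 = 0" "x = (x1, x2, x3)"
  shows "pt x \<in> pt ` frame_coords"
proof -
  have img: "pt x \<in> pt ` frame_coords"
    if "c \<noteq> 0" "(c * x1, c * x2, c * x3) \<in> frame_coords" for c
    using imageI[OF that(2), of pt] unfolding pt_scale[OF that(1)] assms(3) .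
  consider "x1 \<noteq> 0" | "x1 = 0" "x2 \<noteq> 0" | "x1 = 0" "x2 = 0" "x3 \<noteq> 0"
    using assms by auto
  then show ?thesis
  proof cases
    case 1
    then show ?thesis using assms(2) by (intro img[of "1 / x1"]) (auto simp: mult.commute)
  next
    case 2
    then show ?thesis by (intro img[of "1 / x2"]) auto
  next
    case 3
    then show ?thesis by (intro img[of "1 / x3"]) auto
  qed
qed

lemma points_eq:
  assumes "L1 = {P \<in> pg_points. P \<subseteq> W1}" "L2 = {P \<in> pg_points. P \<subseteq> W2}" "L3 = {P \<in> pg_points. P \<subseteq> W3}"
  shows "insert (pt EE) (L1 \<union> L2 \<union> L3) = pt ` frame_coords"
proof (intro equalityI subsetI)
  fix P assume P: "P \<in> insert (pt EE) (L1 \<union> L2 \<union> L3)"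
  show "P \<in> pt ` frame_coords"
  proof (cases "P = pt EE")
    case True
    then show ?thesis by blast
  next
    case False
    then have "P \<in> pg_points" using P assms by blast
    then obtain x where x: "P = pt x" "x \<noteq> (0, 0, 0)" by (rule point_coords)
    obtain x1 x2 x3 where x': "x = (x1, x2, x3)" by (metis prod.exhaust)
    have "x1 = 0 \<or> x2 = 0 \<or> x3 = 0"
      using P False assms pt_subset_iff[of x1 x2 x3] unfolding x x' by blast
    then show ?thesis unfolding x(1) by (rule normalize_coords[OF x(2) _ x'])
  qed
next
  fix P assume "P \<in> pt ` frame_coords"
  then obtain x where x: "P = pt x" "x \<in> frame_coords" by blast
  have P: "P \<in> pg_points" using x pt_mem frame_coords_nonzero by blast
  show "P \<in> insert (pt EE) (L1 \<union> L2 \<union> L3)"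
  proof (cases "x = EE")
    case True
    then show ?thesis using x(1) by blast
  next
    case False
    obtain x1 x2 x3 where x': "x = (x1, x2, x3)" by (metis prod.exhaust)
    have "x1 = 0 \<or> x2 = 0 \<or> x3 = 0"
      using False x(2) unfolding x' by (auto elim!: frame_coordsE)
    then have "P \<subseteq> W1 \<or> P \<subseteq> W2 \<or> P \<subseteq> W3"
      unfolding x(1) x' using pt_subset_iff[of x1 x2 x3] by blast
    then show ?thesis using P assms by blast
  qed
qed

text \<open>Proportional normalized triples share their first nonzero coordinate, which is one, so
  the factor is one.\<close>

lemma inj_on_pt: "inj_on pt frame_coords"
proof (rule inj_onI)
  fix x y assume K: "x \<in> frame_coords" "y \<in> frame_coords" and eq: "pt x = pt y"
  obtain x1 x2 x3 y1 y2 y3 where [simp]: "x = (x1, x2, x3)" "y = (y1, y2, y3)"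
    by (metis prod.exhaust)
  have "lin x \<in> pt y" using eq vec.span_base[of "lin x" "{lin x}"] by simp
  then obtain c where "lin x = c *s lin y" by (auto simp: vec.span_singleton)
  then have "x1 = c * y1" "x2 = c * y2" "x3 = c * y3"
    by (simp_all add: lin_scale lin_eq_iff del: lin.simps)
  then show "x = y" using K by (auto elim!: frame_coordsE)
qed

lemma pt_eq_iff: "x \<in> frame_coords \<Longrightarrow> y \<in> frame_coords \<Longrightarrow> pt x = pt y \<longleftrightarrow> x = y"
  by (rule inj_on_eq_iff[OF inj_on_pt])

declare lin.simps [simp del]

end

section \<open>The matroid of the frame points and its universal partial field\<close>

context triangle
begin

context
  fixes M :: "'f pg_point matroid"
  assumes M: "M = pg_restriction (pt ` frame_coords)" and fin: "finite (UNIV :: 'f set)"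
begin

lemma ground_eq: "ground M = pt ` frame_coords"
  by (simp add: M pg_restriction_def)

lemma finite_ground: "finite (pt ` frame_coords)"
proof -
  have "finite (frame_coords :: 'f triple set)"
    by (rule finite_subset[OF subset_UNIV]) (simp add: fin finite_Prod_UNIV)
  then show ?thesis by simp
qed

lemma det_corners: "det3 E1 E2 E3 = (1 :: 'f)"
  by simp

lemma dim_ground: "vec.dim (\<Union>(pt ` frame_coords)) = 3"
proof -
  have "vec.dim (\<Union>{pt E1, pt E2, pt E3}) = 3"
    using det3_nonzero_iff_points[of E1 E2 E3] det_corners by (metis zero_neq_one)
  moreover have "\<Union>{pt E1, pt E2, pt E3} \<subseteq> \<Union>(pt ` frame_coords)"
    by (intro Union_mono) blast
  ultimately have "3 \<le> vec.dim (\<Union>(pt ` frame_coords))"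
    using vec.dim_subset by metis
  moreover have "vec.dim (\<Union>(pt ` frame_coords)) \<le> 3"
    using vec.dim_subset[OF subset_UNIV[of "\<Union>(pt ` frame_coords)"]] by (simp only: vec3_dim_UNIV)
  ultimately show ?thesis by simp
qed

lemma bases_eq: "bases M = {B. B \<subseteq> pt ` frame_coords \<and> pg_indep B \<and> card B = 3}"
proof -
  have "pt ` frame_coords \<subseteq> pg_points" using pt_mem frame_coords_nonzero by blast
  from bases_pg_restriction[OF finite_ground this] show ?thesis unfolding M dim_ground .
qed

text \<open>A nonzero determinant also forces three distinct points, since the dimension of a union
  of points is at most their number.\<close>

lemma basis_iff:
  assumes "x \<in> frame_coords" "y \<in> frame_coords" "z \<in> frame_coords"
  shows "{pt x, pt y, pt z} \<in> bases M \<longleftrightarrow> det3 x y z \<noteq> 0"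
proof -
  have pts: "{pt x, pt y, pt z} \<subseteq> pg_points"
    using assms pt_mem frame_coords_nonzero by blast
  have "card {pt x, pt y, pt z} = 3" if "vec.dim (\<Union>{pt x, pt y, pt z}) = 3"
  proof -
    have "3 \<le> card {pt x, pt y, pt z}"
      using dim_Union_le_card[OF _ pts] unfolding that by simp
    moreover have "card {pt x, pt y, pt z} \<le> 3"
      using card_length[of "[pt x, pt y, pt z]"] by simp
    ultimately show ?thesis by simp
  qed
  then show ?thesis
    unfolding bases_eq pg_indep_def det3_nonzero_iff_points using assms pts by auto
qed

lemma rank_eq: "matroid_rank M = 3"
proof -
  have "{pt E1, pt E2, pt E3} \<in> bases M"
    by (subst basis_iff) (simp_all del: det3.simps add: det_corners)
  then have "(SOME B. B \<in> bases M) \<in> bases M" by (rule someI)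
  then show ?thesis by (simp add: matroid_rank_def bases_eq)
qed

lemma tuples_eq: "tuples M = {[pt x, pt y, pt z] | x y z.
    x \<in> frame_coords \<and> y \<in> frame_coords \<and> z \<in> frame_coords}"
proof (intro equalityI subsetI)
  fix Z assume "Z \<in> tuples M"
  then have "length Z = 3" "set Z \<subseteq> pt ` frame_coords"
    by (auto simp: tuples_def rank_eq ground_eq)
  then obtain P Q S where Z: "Z = [P, Q, S]" "P \<in> pt ` frame_coords" "Q \<in> pt ` frame_coords"
    "S \<in> pt ` frame_coords"
    by (auto simp: numeral_3_eq_3 length_Suc_conv)
  then show "Z \<in> {[pt x, pt y, pt z] | x y z. x \<in> frame_coords \<and> y \<in> frame_coords \<and> z \<in> frame_coords}"
    by blast
qed (auto simp: tuples_def rank_eq ground_eq)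

lemma pt_tuple:
  "x \<in> frame_coords \<Longrightarrow> y \<in> frame_coords \<Longrightarrow> z \<in> frame_coords \<Longrightarrow> [pt x, pt y, pt z] \<in> tuples M"
  unfolding tuples_eq by blast

definition br_class where "br_class x y z = bracket_class M [pt x, pt y, pt z]"

definition coords where "coords = the_inv_into frame_coords pt"

lemma coords_pt [simp]: "x \<in> frame_coords \<Longrightarrow> coords (pt x) = x"
  unfolding coords_def by (rule the_inv_into_f_f[OF inj_on_pt])

text \<open>The given representation over the field satisfies all four families of relations.
  Division by zero in the value of an inverse symbol is harmless: relation (4) involves basis tuples
  only, where the determinant is nonzero.\<close>

lemma bracket_relations_vanish:
  fixes f
  defines "g \<equiv> \<lambda>Z. det3 (coords (Z ! 0)) (coords (Z ! 1)) (coords (Z ! 2))"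
  assumes f: "\<And>Z. f (Bracket Z) = g Z" "\<And>Z. f (Inv_Bracket Z) = 1 / g Z"
    and p: "p \<in> bracket_relations M"
  shows "eval_mpoly f p = 0"
proof -
  note eval = eval_mpoly_diff eval_mpoly_mult eval_mpoly_of_int eval_mpoly_one eval_mpoly_mvar f
  have basis: "set Z \<in> bases M \<longleftrightarrow> g Z \<noteq> 0" if "Z \<in> tuples M" for Z
    using that unfolding tuples_eq
    by (auto simp del: det3.simps simp: basis_iff g_def)
  from p show ?thesis
    unfolding bracket_relations_def Un_iff mem_Collect_eq
  proof (elim disjE exE conjE, goal_cases)
    case (1 Z)
    then show ?case unfolding 1(1) eval using basis[OF 1(2)] by simp
  next
    case (2 Z \<sigma>)
    have \<sigma>: "\<sigma> permutes {..<3}" using 2(3) by (simp add: rank_eq)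
    have len: "length Z = 3" using 2(2) by (simp add: tuples_def rank_eq)
    have "g (permute_list \<sigma> Z) = of_int (sign \<sigma>) * g Z"
      unfolding g_def using det3_permute[OF \<sigma>, of "\<lambda>i. coords (Z ! i)"] \<sigma> len
      by (simp add: permute_list_nth)
    then show ?case
      unfolding 2(1) eval by (cases "sign \<sigma> = 1") (auto simp: sign_def split: if_splits)
  next
    case (3 x1 x2 y1 y2 W)
    from 3(3) obtain w where "W = [w]" by (auto simp: rank_eq numeral_2_eq_2 numeral_3_eq_3 length_Suc_conv)
    then show ?case
      unfolding 3(1) eval g_def by (simp add: det3_plucker[of "coords x1" "coords x2"])
  next
    case (4 Z)
    then have "g Z \<noteq> 0" using basis by (auto simp: basis_tuples_def)
    then show ?case unfolding 4(1) eval by simp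
  qed
qed

lemma bracket_ring_nontrivial_frame: "\<one>\<^bsub>bracket_ring M\<^esub> \<noteq> \<zero>\<^bsub>bracket_ring M\<^esub>"
proof -
  define g where "g = (\<lambda>Z. det3 (coords (Z ! 0)) (coords (Z ! 1)) (coords (Z ! 2)))"
  define f where "f = (\<lambda>v. case v of Bracket Z \<Rightarrow> g Z | Inv_Bracket Z \<Rightarrow> 1 / g Z)"
  show ?thesis
    by (rule bracket_ring_nontrivial[of M f], rule bracket_relations_vanish)
      (simp_all add: f_def g_def)
qed

lemma bracket_function_br_class: "bracket_function (bracket_ring M) br_class"
proof -
  interpret B: cring "bracket_ring M" by (rule cring_bracket_ring)
  have swap: "Transposition.transpose a c permutes {..<matroid_rank M} \<and> sign (Transposition.transpose a c) = - 1"
    if "a < 3" "c < 3" "a \<noteq> c" for a c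
    using that by (auto simp: rank_eq sign_swap_id intro!: permutes_swap_id)
  show ?thesis
  proof unfold_locales
    fix x y z :: "'f triple"
    assume K: "x \<in> frame_coords" "y \<in> frame_coords" "z \<in> frame_coords"
    show "br_class x y z \<in> carrier (bracket_ring M)"
      unfolding br_class_def by (rule bracket_class_closed[OF pt_tuple[OF K]])
    show "br_class x y z = \<zero>\<^bsub>bracket_ring M\<^esub>" if "det3 x y z = 0"
      unfolding br_class_def using that basis_iff[OF K] by (intro bracket_class_zero pt_tuple K) simp
    show "br_class x y z \<in> Units (bracket_ring M)" if "det3 x y z \<noteq> 0"
      unfolding br_class_def using that basis_iff[OF K]
      by (intro bracket_class_unit) (simp add: basis_tuples_def pt_tuple K)
    show "br_class y x z = \<ominus>\<^bsub>bracket_ring M\<^esub> br_class x y z"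
      using bracket_class_odd[OF pt_tuple[OF K], of "Transposition.transpose 0 1"] swap[of 0 1]
      by (simp add: br_class_def permute_list_def upt_rec numeral_eq_Suc Transposition.transpose_def)
    show "br_class x z y = \<ominus>\<^bsub>bracket_ring M\<^esub> br_class x y z"
      using bracket_class_odd[OF pt_tuple[OF K], of "Transposition.transpose 1 2"] swap[of 1 2]
      by (simp add: br_class_def permute_list_def upt_rec numeral_eq_Suc Transposition.transpose_def)
  next
    fix x1 x2 y1 y2 w :: "'f triple"
    assume K: "x1 \<in> frame_coords" "x2 \<in> frame_coords" "y1 \<in> frame_coords" "y2 \<in> frame_coords"
      "w \<in> frame_coords"
    show "br_class x1 x2 w \<otimes>\<^bsub>bracket_ring M\<^esub> br_class y1 y2 w =
        br_class y1 x2 w \<otimes>\<^bsub>bracket_ring M\<^esub> br_class x1 y2 w \<oplus>\<^bsub>bracket_ring M\<^esub>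
        br_class y2 x2 w \<otimes>\<^bsub>bracket_ring M\<^esub> br_class y1 x1 w"
      unfolding br_class_def by (rule bracket_class_plucker) (use K in \<open>auto simp: ground_eq rank_eq\<close>)
  qed
qed

text \<open>Indices above 2 repeat the third coordinate, so a linear relation between the
  coordinates holds for every natural number as index, as a coordinate matrix demands.\<close>

definition coord_fun where
  "coord_fun P i = (case coords P of (x1, x2, x3) \<Rightarrow> if i = 0 then x1 else if i = (1::nat) then x2 else x3)"

theorem universal_partial_field_triangle:
  "pf_isomorphic (universal_partial_field M) (field_pfield :: 'f pfield)"
proof -
  interpret bf: bracket_function "bracket_ring M" br_class by (rule bracket_function_br_class)
  obtain h c t where h: "h \<in> ring_hom ring_of_type_algebra (bracket_ring M)"
    and c: "c \<in> Units (bracket_ring M)"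
    and t: "\<And>x. x \<in> frame_coords \<Longrightarrow> t x \<in> Units (bracket_ring M)"
    and br: "\<And>x y z. \<lbrakk>x \<in> frame_coords; y \<in> frame_coords; z \<in> frame_coords\<rbrakk> \<Longrightarrow>
      br_class x y z = c \<otimes>\<^bsub>bracket_ring M\<^esub> t x \<otimes>\<^bsub>bracket_ring M\<^esub> t y \<otimes>\<^bsub>bracket_ring M\<^esub> t z
        \<otimes>\<^bsub>bracket_ring M\<^esub> h (det3 x y z)"
    by (rule bf.coordinatization) blast
  interpret fh: field_hom "bracket_ring M" h
    by unfold_locales (rule h, rule bracket_ring_nontrivial_frame)
  let ?R = "bracket_ring M"
  define B where "B = (SOME B. B \<in> basis_tuples M)"
  have "[pt E1, pt E2, pt E3] \<in> basis_tuples M"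
    unfolding basis_tuples_def using basis_iff[of E1 E2 E3] pt_tuple[of E1 E2 E3] det_corners by simp
  then have B: "B \<in> basis_tuples M" unfolding B_def by (rule someI)
  then obtain x y z where Bxyz: "B = [pt x, pt y, pt z]"
    and K: "x \<in> frame_coords" "y \<in> frame_coords" "z \<in> frame_coords"
    unfolding basis_tuples_def tuples_eq by blast
  have d: "det3 x y z \<noteq> 0"
    using B basis_iff[OF K] unfolding basis_tuples_def Bxyz by simp
  then have "x \<noteq> y" "x \<noteq> z" "y \<noteq> z" by (auto simp: det3_eq)
  then have ne: "pt x \<noteq> pt y" "pt x \<noteq> pt z" "pt y \<noteq> pt z"
    using K by (simp_all add: pt_eq_iff)
  \<comment> \<open>Cramer's rule for \<open>v\<close> in the basis \<open>x\<close>,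
    \<open>y\<close>, \<open>z\<close>: the label \<open>u\<close> selects the vector that is
    replaced by \<open>v\<close>.\<close>
  define a where "a = (\<lambda>u v. det3 (if u = pt x then coords v else x) (if u = pt y then coords v else y)
     (if u = pt z then coords v else z) / det3 x y z)"
  define t' where "t' = (\<lambda>P. t (coords P))"
  obtain D where A: "representation_matrix M B = ({pt x, pt y, pt z}, ground M - {pt x, pt y, pt z}, D)"
    and D: "\<And>u v. D u v = bracket_class M (map (\<lambda>x. if x = u then v else x) B)
             \<otimes>\<^bsub>bracket_ring M\<^esub> inv\<^bsub>bracket_ring M\<^esub> (bracket_class M B)"
    by (simp add: representation_matrix_def Bxyz)
  have coord: "fh.coordinate_matrix t' coord_fun a (representation_matrix M B)"
  proof -
    have entry: "D u v = inv\<^bsub>?R\<^esub> (t' u) \<otimes>\<^bsub>?R\<^esub> h (a u v) \<otimes>\<^bsub>?R\<^esub> t' v"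
      if u: "u \<in> {pt x, pt y, pt z}" and v: "v \<in> pt ` frame_coords" for u v
    proof -
      obtain v' where v': "v = pt v'" "v' \<in> frame_coords" using v by blast
      note tU = c t[OF K(1)] t[OF K(2)] t[OF K(3)] t[OF v'(2)]
      note tC = tU[THEN bf.Units_closed]
      \<comment> \<open>Here \<open>p\<close> collects the global unit and the scales of the two
        basis points that remain, which cancel, while \<open>s\<close> is the scale of the point
        being replaced.\<close>
      have key: "(p \<otimes>\<^bsub>?R\<^esub> t v' \<otimes>\<^bsub>?R\<^esub> h d1) \<otimes>\<^bsub>?R\<^esub> inv\<^bsub>?R\<^esub> (p \<otimes>\<^bsub>?R\<^esub> s \<otimes>\<^bsub>?R\<^esub> h (det3 x y z)) =
          inv\<^bsub>?R\<^esub> s \<otimes>\<^bsub>?R\<^esub> h (d1 / det3 x y z) \<otimes>\<^bsub>?R\<^esub> t v'"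
        if "p \<in> Units ?R" "s \<in> Units ?R" for p s d1
      proof -
        have pC: "p \<in> carrier ?R" "s \<in> carrier ?R" using that bf.Units_closed by auto
        have "inv\<^bsub>?R\<^esub> (p \<otimes>\<^bsub>?R\<^esub> s \<otimes>\<^bsub>?R\<^esub> h (det3 x y z)) = inv\<^bsub>?R\<^esub> (p \<otimes>\<^bsub>?R\<^esub> h (det3 x y z) \<otimes>\<^bsub>?R\<^esub> s)"
          using pC by (simp add: bf.m_ac)
        also have "\<dots> = inv\<^bsub>?R\<^esub> s \<otimes>\<^bsub>?R\<^esub> h (1 / det3 x y z) \<otimes>\<^bsub>?R\<^esub> inv\<^bsub>?R\<^esub> p"
          using that d by (rule fh.inv_entry)
        finally have "(p \<otimes>\<^bsub>?R\<^esub> t v' \<otimes>\<^bsub>?R\<^esub> h d1) \<otimes>\<^bsub>?R\<^esub> inv\<^bsub>?R\<^esub> (p \<otimes>\<^bsub>?R\<^esub> s \<otimes>\<^bsub>?R\<^esub> h (det3 x y z)) =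
            (p \<otimes>\<^bsub>?R\<^esub> inv\<^bsub>?R\<^esub> p) \<otimes>\<^bsub>?R\<^esub> (inv\<^bsub>?R\<^esub> s \<otimes>\<^bsub>?R\<^esub> (h d1 \<otimes>\<^bsub>?R\<^esub> h (1 / det3 x y z)) \<otimes>\<^bsub>?R\<^esub> t v')"
          using pC that tC by (simp add: bf.m_ac del: bf.Units_r_inv bf.Units_l_inv)
        then show ?thesis
          using pC that tC by (simp flip: fh.h_mult)
      qed
      let ?x = "if u = pt x then v' else x" and ?y = "if u = pt y then v' else y"
        and ?z = "if u = pt z then v' else z"
      have "map (\<lambda>x. if x = u then v else x) B = [pt ?x, pt ?y, pt ?z]"
        unfolding Bxyz v' by auto
      then have "D u v = br_class ?x ?y ?z \<otimes>\<^bsub>?R\<^esub> inv\<^bsub>?R\<^esub> (br_class x y z)"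
        unfolding D br_class_def Bxyz by simp
      also have "\<dots> = inv\<^bsub>?R\<^esub> (t' u) \<otimes>\<^bsub>?R\<^esub> h (det3 ?x ?y ?z / det3 x y z) \<otimes>\<^bsub>?R\<^esub> t v'"
      proof -
        consider "u = pt x" | "u = pt y" | "u = pt z" using u by blast
        then show ?thesis
        proof cases
          case 1
          then show ?thesis
            using key[of "c \<otimes>\<^bsub>?R\<^esub> t y \<otimes>\<^bsub>?R\<^esub> t z" "t x" "det3 v' y z"] ne tU tC K v'
            by (simp add: br t'_def bf.m_ac del: det3.simps)
        next
          case 2
          then show ?thesis
            using key[of "c \<otimes>\<^bsub>?R\<^esub> t x \<otimes>\<^bsub>?R\<^esub> t z" "t y" "det3 x v' z"] ne tU tC K v'
            by (simp add: br t'_def bf.m_ac del: det3.simps)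
        next
          case 3
          then show ?thesis
            using key[of "c \<otimes>\<^bsub>?R\<^esub> t x \<otimes>\<^bsub>?R\<^esub> t y" "t z" "det3 x y v'"] ne tU tC K v'
            by (simp add: br t'_def bf.m_ac del: det3.simps)
        qed
      qed
      finally show ?thesis
        unfolding a_def t'_def v'(1) coords_pt[OF v'(2)] .
    qed
    have comb: "coord_fun v i = (\<Sum>u\<in>{pt x, pt y, pt z}. a u v * coord_fun u i)" for v i
    proof -
      obtain x1 x2 x3 y1 y2 y3 z1 z2 z3 v1 v2 v3 where
        e: "x = (x1, x2, x3)" "y = (y1, y2, y3)" "z = (z1, z2, z3)" "coords v = (v1, v2, v3)"
        by (metis prod.exhaust)
      have "(\<Sum>u\<in>{pt x, pt y, pt z}. a u v * coord_fun u i) =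
          (det3 (coords v) y z * coord_fun (pt x) i + det3 x (coords v) z * coord_fun (pt y) i
           + det3 x y (coords v) * coord_fun (pt z) i) / det3 x y z"
        using ne by (simp add: a_def add_divide_distrib del: det3.simps)
      also have "det3 (coords v) y z * coord_fun (pt x) i + det3 x (coords v) z * coord_fun (pt y) i
           + det3 x y (coords v) * coord_fun (pt z) i = det3 x y z * coord_fun v i"
        unfolding coord_fun_def coords_pt[OF K(1)] coords_pt[OF K(2)] coords_pt[OF K(3)]
        unfolding e
        by (simp add: algebra_simps)
      finally show ?thesis using d by simp
    qed
    show ?thesis
      unfolding A fh.coordinate_matrix_def prod.case
    proof (intro conjI ballI allI)
      fix u assume "u \<in> {pt x, pt y, pt z} \<union> (ground M - {pt x, pt y, pt z})"
      then have "u \<in> pt ` frame_coords" using K by (auto simp: ground_eq)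
      then show "t' u \<in> Units ?R" using t by (auto simp: t'_def)
    next
      fix u v assume "u \<in> {pt x, pt y, pt z}" "v \<in> ground M - {pt x, pt y, pt z}"
      then show "D u v = inv\<^bsub>?R\<^esub> (t' u) \<otimes>\<^bsub>?R\<^esub> h (a u v) \<otimes>\<^bsub>?R\<^esub> t' v"
        by (intro entry) (auto simp: ground_eq)
    qed (auto intro: comb)
  qed
  have Cr: "matroid_cross_ratios M = cross_ratios ?R (representation_matrix M B)"
    by (simp add: matroid_cross_ratios_def B_def)
  have sub: "matroid_cross_ratios M \<subseteq> range h"
    unfolding Cr by (rule fh.cross_ratios_subset[OF fh.coordinate_matrix_scaled[OF coord]])
  let ?F = "{pt E1, pt E2, pt E3}"
  have neF: "pt E1 \<noteq> pt E2" "pt E1 \<noteq> pt E3" "pt E2 \<noteq> pt E3"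
    by (simp_all add: pt_eq_iff)
  have cf: "coord_fun (pt v) i = (case v of (x1, x2, x3) \<Rightarrow> if i = 0 then x1 else if i = 1 then x2 else x3)"
    if "v \<in> frame_coords" for v i
    using that by (simp add: coord_fun_def)
  \<comment> \<open>A corner has a nonzero coordinate at a position where the other two corners are
    zero.\<close>
  have indep: "\<exists>i. coord_fun f i \<noteq> (\<Sum>u\<in>?F - {f}. k u * coord_fun u i)" if "f \<in> ?F" for f k
  proof -
    have z: "(\<Sum>u\<in>?F - {f}. k u * coord_fun u i) = 0" if "\<And>u. u \<in> ?F - {f} \<Longrightarrow> coord_fun u i = 0" for i
      by (rule sum.neutral) (use that in auto)
    consider "f = pt E1" | "f = pt E2" | "f = pt E3" using \<open>f \<in> ?F\<close> by blast
    then show ?thesis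
    proof cases
      case 1
      then show ?thesis by (intro exI[of _ 0]) (subst z, auto simp: cf)
    next
      case 2
      then show ?thesis by (intro exI[of _ 1]) (subst z, auto simp: cf)
    next
      case 3
      then show ?thesis by (intro exI[of _ 2]) (subst z, auto simp: cf)
    qed
  qed
  have "\<exists>S' T' D' a'. matrix_minor ?R (representation_matrix M B) (S', T', D') \<and>
      fh.coordinate_matrix t' coord_fun a' (S', T', D') \<and> ?F \<subseteq> S' \<and>
      S' \<union> T' = {pt x, pt y, pt z} \<union> (ground M - {pt x, pt y, pt z}) \<and> card S' = card {pt x, pt y, pt z}"
  proof (rule fh.pivot_to_basis[OF _ _ _ indep])
    show "matrix_minor ?R (representation_matrix M B)
        ({pt x, pt y, pt z}, ground M - {pt x, pt y, pt z}, D)"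
      unfolding A by (rule matrix_minor.refl)
    show "fh.coordinate_matrix t' coord_fun a ({pt x, pt y, pt z}, ground M - {pt x, pt y, pt z}, D)"
      using coord unfolding A .
    show "?F \<subseteq> {pt x, pt y, pt z} \<union> (ground M - {pt x, pt y, pt z})"
      unfolding ground_eq by blast
  qed simp_all
  then obtain S' T' D' a' where minor: "matrix_minor ?R (representation_matrix M B) (S', T', D')"
    and coord': "fh.coordinate_matrix t' coord_fun a' (S', T', D')" and FS: "?F \<subseteq> S'"
    and un: "S' \<union> T' = {pt x, pt y, pt z} \<union> (ground M - {pt x, pt y, pt z})"
    and cardS: "card S' = card {pt x, pt y, pt z}"
    by (elim exE conjE) (rule that)
  have fS: "finite S'" and disj: "S' \<inter> T' = {}"
    using coord' unfolding fh.coordinate_matrix_def prod.case by blast+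
  have S': "S' = ?F"
    using card_seteq[OF fS FS] cardS ne neF by simp
  have "{pt x, pt y, pt z} \<subseteq> pt ` frame_coords" using K by simp
  with un have "S' \<union> T' = pt ` frame_coords"
    unfolding ground_eq by (simp only: Un_Diff_cancel Un_absorb1)
  with disj have T': "T' = pt ` frame_coords - ?F"
    unfolding S'[symmetric] by blast
  have sup: "h p \<in> matroid_cross_ratios M" if "p \<noteq> 0" "p \<noteq> 1" for p
    unfolding Cr
  proof (rule fh.cross_ratio_of_coordinates[OF minor[unfolded S'] coord'[unfolded S']])
    show "finite T'" unfolding T' using finite_ground by simp
    show "distinct [pt E1, pt E2, pt E3]" using neF by simp
    \<comment> \<open>\<open>p\<close> must be nonzero for this point to differ from the corner
      \<open>E1\<close>, and different from one for the two columns to be distinct.\<close>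
    show v: "pt (1, p, 0) \<in> T'" and w: "pt (1, 1, 0) \<in> T'"
      unfolding T' using that by (simp_all add: pt_eq_iff)
    show "pt (1, p, 0) \<noteq> pt (1, 1, 0)"
      using that by (simp_all add: pt_eq_iff)
    \<comment> \<open>With the corners as row labels, the entries of a column are the coordinates of
      its label.\<close>
    have X: "coord_fun v i = a' (pt E1) v * coord_fun (pt E1) i + a' (pt E2) v * coord_fun (pt E2) i
        + a' (pt E3) v * coord_fun (pt E3) i" if "v \<in> T'" for v i
    proof -
      have "coord_fun v i = (\<Sum>u\<in>?F. a' u v * coord_fun u i)"
        using coord' that unfolding S' fh.coordinate_matrix_def prod.case by blast
      also have "\<dots> = a' (pt E1) v * coord_fun (pt E1) i + a' (pt E2) v * coord_fun (pt E2) i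
        + a' (pt E3) v * coord_fun (pt E3) i"
        using neF by (simp add: add.assoc)
      finally show ?thesis .
    qed
    show "a' (pt E1) (pt (1, p, 0)) = 1" "a' (pt E2) (pt (1, p, 0)) = p"
      using X[OF v, of 0] X[OF v, of 1] by (simp_all add: cf)
    show "a' (pt E1) (pt (1, 1, 0)) = 1" "a' (pt E2) (pt (1, 1, 0)) = 1"
      using X[OF w, of 0] X[OF w, of 1] by (simp_all add: cf)
  qed
  show ?thesis
    by (rule universal_partial_field_isomorphic_field[OF h bracket_ring_nontrivial_frame sub sup])
qed

end

end

theorem theorem4p19:
  fixes q :: nat
    and L1 L2 L3 :: "('f :: {field, finite}) pg_point set"
    and e :: "'f pg_point"
  assumes "primepow q"
    and "CARD('f) = q"
    and "L1 \<in> pg_lines" and "L2 \<in> pg_lines" and "L3 \<in> pg_lines"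
    and "L1 \<noteq> L2" and "L1 \<noteq> L3" and "L2 \<noteq> L3"
    and "L1 \<inter> L2 \<inter> L3 = {}"
    and "e \<in> pg_points - (L1 \<union> L2 \<union> L3)"
  shows "pf_isomorphic (universal_partial_field (Q_plus_matroid L1 L2 L3 e))
           (field_pfield :: 'f pfield)"
proof -
  obtain W1 W2 W3 where W: "vec.subspace W1" "vec.subspace W2" "vec.subspace W3"
    "vec.dim W1 = 2" "vec.dim W2 = 2" "vec.dim W3 = 2"
    and L: "L1 = {P \<in> pg_points. P \<subseteq> W1}" "L2 = {P \<in> pg_points. P \<subseteq> W2}" "L3 = {P \<in> pg_points. P \<subseteq> W3}"
    using assms(3-5) by (auto simp: pg_lines_def)
  \<comment> \<open>A nonzero common vector would span a point on all three lines. Hence a vector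
    common to two of the planes lies outside the third, which gives the corners.\<close>
  have no_common: "v = 0" if "v \<in> W1" "v \<in> W2" "v \<in> W3" for v
  proof (rule ccontr)
    assume "v \<noteq> 0"
    then have "vec.span {v} \<in> pg_points" by (auto simp: pg_points_iff)
    then have "vec.span {v} \<in> L1 \<inter> L2 \<inter> L3"
      using that W by (simp add: L span_subset_subspace_iff)
    then show False using assms(9) by blast
  qed
  obtain v1 where v1: "v1 \<noteq> 0" "v1 \<in> W2" "v1 \<in> W3" using planes_meet[OF W(2,3,5,6)] .
  obtain v2 where v2: "v2 \<noteq> 0" "v2 \<in> W1" "v2 \<in> W3" using planes_meet[OF W(1,3,4,6)] .
  obtain v3 where v3: "v3 \<noteq> 0" "v3 \<in> W1" "v3 \<in> W2" using planes_meet[OF W(1,2,4,5)] .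
  interpret v: triangle W1 W2 W3 v1 v2 v3
    by unfold_locales (use W v1 v2 v3 no_common in auto)
  obtain x where x: "e = v.pt x" using assms(10) v.point_coords by blast
  obtain x1 x2 x3 where x': "x = (x1, x2, x3)" by (metis prod.exhaust)
  have nz: "x1 \<noteq> 0" "x2 \<noteq> 0" "x3 \<noteq> 0"
    using assms(10) v.pt_subset_iff[of x1 x2 x3] unfolding x x' L by blast+
  \<comment> \<open>The coordinates of \<open>e\<close> are absorbed into the corners, which makes
    \<open>e\<close> the unit point of the frame. They are nonzero because \<open>e\<close> lies on
    none of the lines.\<close>
  interpret u: triangle W1 W2 W3 "x1 *s v1" "x2 *s v2" "x3 *s v3"
    by unfold_locales
      (use W v1 v2 v3 nz no_common in \<open>auto simp: v.scale_mem_iff intro: vec.subspace_scale\<close>)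
  have "e = u.pt EE" unfolding x x' by (simp add: v.lin.simps u.lin.simps)
  then have "Q_plus_matroid L1 L2 L3 e = pg_restriction (u.pt ` frame_coords)"
    by (simp add: Q_plus_matroid_def Q_matroid_def pg_restriction_def u.points_eq[OF L] del: u.lin.simps)
  then show ?thesis
    by (rule u.universal_partial_field_triangle) simp
qed

end
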